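(* Let $\{Z_n\}_{n\ge0}$ be the $d$-dimensional branching random walk described in the context, with offspring mean $m=1$, and suppose the offspring generating function satisfies $f(s)=s+(1-s)^{1+\beta}L(1-s)$ for $s\in[0,1]$, for some $\beta\in(0,\frac1d]$ and some function $L$ on $[0,1]$ slowly varying at $0+$ (i.e. $\lim_{s\to0+}L(sx)/L(s)=1$ for all $x\in(0,1]$). Suppose $\mathbb{E}[|X|^{\alpha}]<\infty$ for some $\alpha>(\beta+1)d$. Then for every $r>0$, $$\lim_{n\to\infty}\mathbb{P}\left(\frac{R_n}{b_n}\ge r\right)=\exp\left\{-v_d(r)(\beta^{-1})^{\beta^{-1}}\right\},$$ where $b_n:=\big[nL\big(\mathbb{P}_{\delta_0}(|Z_n|>0)\big)\big]^{\frac{1}{\beta d}}$, $\mathbb{P}_{\delta_0}(|Z_n|>0)$ is the probability that the branching random walk started from a single particle at the origin has at least one particle at generation $n$, and $v_d(r)=\frac{\pi^{d/2}r^d}{\Gamma(d/2+1)}$.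
   Context: Let $\{p_k\}_{k\ge0}$ be an offspring distribution on $\{0,1,2,\dots\}$ with $p_0<1$, $p_1<1$, mean $m=\sum_k kp_k$ and generating function $f(s)=\sum_k p_ks^k$. Let $X$ be an $\mathbb{R}^d$-valued random vector (the displacement) with mean zero whose components are i.i.d. The branching random walk $\{Z_n\}_{n\ge0}$: under $\mathbb{P}$, $Z_0$ is a Poisson random measure on $\mathbb{R}^d$ with Lebesgue intensity (under $\mathbb{P}_{\delta_0}$, $Z_0$ is a single particle at $0$); at each generation every particle independently is replaced by a random number of children with law $\{p_k\}$, each child independently displaced from its parent's position by an independent copy of $X$; $Z_n$ is the counting measure of particle positions at generation $n$ and $|Z_n|=Z_n(\mathbb{R}^d)$. Let $B(u)=\{x\in\mathbb{R}^d:|x|<u\}$ and $R_n:=\sup\{u>0:Z_n(B(u))=0\}$ (with $\sup\emptyset=0$). *)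

theory Defs
  imports "HOL-Probability.Probability"
begin

text \<open>Ulam--Harris encoding of the branching random walk.
  Initial particles are indexed by i :: nat (positions Y i); a particle of
  generation n descending from root i is a word w :: nat list of length n.
  xi (i,w) is the number of children of particle (i,w), Xd (i,w) the
  displacement of particle (i,w) from its parent (for w nonempty).\<close>

definition brw_alive :: "(nat \<times> nat list \<Rightarrow> 'a \<Rightarrow> nat) \<Rightarrow> nat \<Rightarrow> nat list \<Rightarrow> 'a \<Rightarrow> bool" where
  "brw_alive xi i w \<omega> \<longleftrightarrow> (\<forall>j<length w. w ! j < xi (i, take j w) \<omega>)"

definition brw_position ::
  "(nat \<Rightarrow> 'a \<Rightarrow> real^'d) \<Rightarrow> (nat \<times> nat list \<Rightarrow> 'a \<Rightarrow> real^'d) \<Rightarrow> nat \<Rightarrow> nat list \<Rightarrow> 'a \<Rightarrow> real^'d" where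
  "brw_position Y Xd i w \<omega> = Y i \<omega> + (\<Sum>j\<in>{1..length w}. Xd (i, take j w) \<omega>)"

definition brw_count ::
  "(nat \<times> nat list \<Rightarrow> 'a \<Rightarrow> nat) \<Rightarrow> (nat \<Rightarrow> 'a \<Rightarrow> real^'d) \<Rightarrow> (nat \<times> nat list \<Rightarrow> 'a \<Rightarrow> real^'d)
    \<Rightarrow> nat \<Rightarrow> 'a \<Rightarrow> (real^'d) set \<Rightarrow> enat" where
  "brw_count xi Y Xd n \<omega> B =
     (let S = {(i, w). length w = n \<and> brw_alive xi i w \<omega> \<and> brw_position Y Xd i w \<omega> \<in> B}
      in if finite S then enat (card S) else \<infinity>)"

text \<open>R_n = sup {u > 0. Z_n(B(u)) = 0}, with sup of the empty set = 0 (extended real valued).\<close>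
definition brw_radius ::
  "(nat \<times> nat list \<Rightarrow> 'a \<Rightarrow> nat) \<Rightarrow> (nat \<Rightarrow> 'a \<Rightarrow> real^'d) \<Rightarrow> (nat \<times> nat list \<Rightarrow> 'a \<Rightarrow> real^'d)
    \<Rightarrow> nat \<Rightarrow> 'a \<Rightarrow> ereal" where
  "brw_radius xi Y Xd n \<omega> =
     sup 0 (SUP u \<in> {u::real. u > 0 \<and> brw_count xi Y Xd n \<omega> (ball 0 u) = 0}. ereal u)"

text \<open>Survival probability of the tree rooted at initial particle 0, i.e. P_{delta_0}(|Z_n| > 0).\<close>
definition brw_survival :: "'a measure \<Rightarrow> (nat \<times> nat list \<Rightarrow> 'a \<Rightarrow> nat) \<Rightarrow> nat \<Rightarrow> real" where
  "brw_survival M xi n = measure M {\<omega> \<in> space M. \<exists>w. length w = n \<and> brw_alive xi 0 w \<omega>}"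

definition poisson_lebesgue_points :: "'a measure \<Rightarrow> (nat \<Rightarrow> 'a \<Rightarrow> real^'d) \<Rightarrow> bool" where
  "poisson_lebesgue_points M Y \<longleftrightarrow>
     (\<forall>i. Y i \<in> borel_measurable M) \<and>
     (\<forall>(k::nat) (A::nat \<Rightarrow> (real^'d) set) (nn::nat \<Rightarrow> nat).
        (\<forall>j<k. A j \<in> sets lborel \<and> bounded (A j)) \<and> disjoint_family_on A {..<k} \<longrightarrow>
        measure M {\<omega> \<in> space M. \<forall>j<k. finite {i. Y i \<omega> \<in> A j} \<and> card {i. Y i \<omega> \<in> A j} = nn j}
        = (\<Prod>j<k. exp (- measure lborel (A j)) * measure lborel (A j) ^ nn j / fact (nn j)))"

definition brw_independent ::
  "'a measure \<Rightarrow> (nat \<Rightarrow> 'a \<Rightarrow> real^'d) \<Rightarrow> (nat \<times> nat list \<Rightarrow> 'a \<Rightarrow> nat) \<Rightarrow> (nat \<times> nat list \<Rightarrow> 'a \<Rightarrow> real^'d) \<Rightarrow> bool" where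
  "brw_independent M Y xi Xd \<longleftrightarrow>
     prob_space.indep_sets M
       (\<lambda>k. case k of
          Inl (_::unit) \<Rightarrow> {(\<lambda>\<omega>. \<lambda>i. Y i \<omega>) -` A \<inter> space M | A. A \<in> sets (PiM (UNIV::nat set) (\<lambda>_. borel))}
        | Inr (Inl x) \<Rightarrow> {xi x -` A \<inter> space M | A. True}
        | Inr (Inr x) \<Rightarrow> {Xd x -` A \<inter> space M | A. A \<in> sets borel})
       UNIV"

definition ball_volume :: "nat \<Rightarrow> real \<Rightarrow> real" where
  "ball_volume d r = pi powr (real d / 2) * r ^ d / Gamma (real d / 2 + 1)"

end

theory Submission
  imports Defs "HOL-Real_Asymp.Real_Asymp"
begin

text \<open>
  Let \<open>q n\<close> be the survival probability and \<open>\<phi> u = f (1 - u) - (1 - u) = u powr (1 + \<beta>) * L u\<close>, which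
  is convex. Then \<open>q (n + 1) = q n - \<phi> (q n)\<close>, and with \<open>g u = \<phi> u / u\<close> and \<open>s\<close> the slope of \<open>\<phi>\<close>
  over the last step, \<open>1 / g (q (n + 1)) - 1 / g (q n) = (s / g (q n) - 1) / (1 - s)\<close>, which tends
  to \<open>\<beta>\<close> by convexity and regular variation. Hence \<open>n g (q n)\<close> tends to \<open>1 / \<beta>\<close>, that is,
  \<open>q n\<close> times the \<open>d\<close>-th power of \<open>b n\<close> tends to \<open>(1 / \<beta>) powr (1 / \<beta>)\<close>.

  On the scale \<open>b n\<close> no family moves. A Fuk--Nagaev bound shows that a single line of descent is
  displaced by more than \<open>\<epsilon> b n\<close> with probability of smaller order than \<open>q n\<close>; as the mean
  population of a family is 1 and the initial points have Lebesgue intensity, the expected number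
  of displaced particles that matter tends to 0. So the event that the ball of radius \<open>r b n\<close> is
  vacant is sandwiched between the events that all families started in the balls of radius
  \<open>(r \<plusminus> \<epsilon>) b n\<close> are extinct, and the latter have probability \<open>exp (- q n * volume)\<close> by
  Poisson thinning.
\<close>

section \<open>Iteration of a critical generating function\<close>

text \<open>Slow variation compares \<open>L\<close> only at points in a fixed ratio, whereas
  \<open>q (n + 1) / q n\<close> changes with \<open>n\<close>. The convexity of
  \<open>\<phi>\<close>, inherited from the power series, bridges this gap: chords to the points
  \<open>x * q n\<close> with fixed \<open>x\<close> enclose the chord to the moving point.

  The moment condition is a balance of exponents. For every \<open>k > \<beta> * d\<close>,
  \<open>n\<close> is of smaller order than \<open>b n powr k\<close>. One of the \<open>n\<close>
  steps of a line has size comparable to \<open>b n\<close> with probability at most of order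
  \<open>n * b n powr (- \<alpha>)\<close>, and this must be small against \<open>q n\<close>, which
  has the order \<open>b n powr (- d)\<close>; hence \<alpha> > (\<beta> + 1) d. The remaining steps
  are truncated and handled by an exponential moment, whose remainder has an exponent \<kappa> \<le>
  2 that must exceed \<beta> d.

  The Poisson hypothesis fixes the law of counts and not that of a single \<open>Y i\<close>.
  Starting points therefore enter only through sums over all \<open>i\<close> or through the random
  index set \<open>{i. Y i \<omega> \<in> A}\<close>.\<close>

text \<open>Each power is convex on the nonnegative reals, and the coefficients are nonnegative. The
  variable is the survival probability \<open>1 - s\<close>, in which \<open>\<phi>\<close> is
  expressed.\<close>

lemma convex_on_pgf:
  fixes p :: "nat \<Rightarrow> real"
  assumes "\<And>k. p k \<ge> 0" "summable p"
  shows "convex_on {0..1} (\<lambda>q. \<Sum>k. p k * (1 - q) ^ k)"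
proof (intro convex_onI)
  have summ: "summable (\<lambda>k. p k * (1 - q) ^ k)" if "q \<in> {0..1}" for q :: real
    using that assms
    by (intro summable_comparison_test'[OF assms(2), of 0])
       (auto simp: abs_mult power_abs intro!: mult_left_le power_le_one)
  fix t x y :: real
  assume t: "0 < t" "t < 1" and xy: "x \<in> {0..1}" "y \<in> {0..1}"
  let ?z = "(1 - t) *\<^sub>R x + t *\<^sub>R y"
  have z: "?z \<in> {0..1}"
    using convexD_alt[OF convex_real_interval(5)[of 0 1] xy, of t] t by auto
  have cp: "convex_on {0..} (\<lambda>x::real. x ^ k)" for k
    by (cases "even k") (auto intro: convex_power_odd convex_on_subset[OF convex_power_even])
  have "p k * (1 - ?z) ^ k \<le> (1 - t) * (p k * (1 - x) ^ k) + t * (p k * (1 - y) ^ k)" for k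
  proof -
    have "((1 - t) *\<^sub>R (1 - x) + t *\<^sub>R (1 - y)) ^ k \<le> (1 - t) * (1 - x) ^ k + t * (1 - y) ^ k"
      using t xy by (intro convex_onD[OF cp]) auto
    moreover have "(1 - t) *\<^sub>R (1 - x) + t *\<^sub>R (1 - y) = 1 - ?z"
      by (simp add: algebra_simps)
    ultimately have "p k * (1 - ?z) ^ k \<le> p k * ((1 - t) * (1 - x) ^ k + t * (1 - y) ^ k)"
      using assms(1)[of k] by (intro mult_left_mono) auto
    then show ?thesis by (simp add: algebra_simps)
  qed
  then have "(\<Sum>k. p k * (1 - ?z) ^ k) \<le> (\<Sum>k. (1 - t) * (p k * (1 - x) ^ k) + t * (p k * (1 - y) ^ k))"
    by (intro suminf_le summ summable_add summable_mult z xy)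
  also have "\<dots> = (1 - t) * (\<Sum>k. p k * (1 - x) ^ k) + t * (\<Sum>k. p k * (1 - y) ^ k)"
    using summ[OF xy(1)] summ[OF xy(2)]
    by (simp add: suminf_add[symmetric] suminf_mult summable_mult)
  finally show "(\<Sum>k. p k * (1 - ?z) ^ k) \<le> (1 - t) * (\<Sum>k. p k * (1 - x) ^ k) + t * (\<Sum>k. p k * (1 - y) ^ k)" .
qed simp

text \<open>Bounding \<open>s ^ k\<close> by \<open>s\<close> for all \<open>k > 0\<close> leaves
  \<open>s + (1 - s) * p 0\<close>. This keeps the survival probability positive in every
  generation.\<close>

lemma pgf_lt_1:
  fixes p :: "nat \<Rightarrow> real"
  assumes "\<And>k. p k \<ge> 0" "p sums 1" "p 0 < 1" "0 \<le> s" "s < 1"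
  shows "(\<Sum>k. p k * s ^ k) < 1"
proof -
  have "(\<Sum>k. p k * s ^ k) \<le> (\<Sum>k. s * p k + (if k = 0 then (1 - s) * p 0 else 0))"
  proof (intro suminf_le)
    show "summable (\<lambda>k. p k * s ^ k)"
      using assms by (intro summable_comparison_test'[OF sums_summable[OF assms(2)], of 0])
        (auto simp: abs_mult power_abs intro!: mult_left_le power_le_one)
    show "summable (\<lambda>k. s * p k + (if k = 0 then (1 - s) * p 0 else 0))"
      by (intro summable_add summable_mult sums_summable[OF assms(2)]) (rule summable_finite[of "{0}"], auto)
    show "p k * s ^ k \<le> s * p k + (if k = 0 then (1 - s) * p 0 else 0)" for k
    proof (cases k)
      case 0
      then show ?thesis by (simp add: algebra_simps)
    next
      case (Suc j)
      have "s ^ k \<le> s" using Suc assms by (simp add: mult_left_le power_le_one)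
      then show ?thesis using Suc assms(1)[of k] by (simp add: mult_left_mono mult.commute[of s])
    qed
  qed
  also have "\<dots> = s + (1 - s) * p 0"
  proof -
    have "(\<lambda>k. s * p k + (if k = 0 then (1 - s) * p 0 else 0)) sums (s * 1 + (1 - s) * p 0)"
      using sums_single[of 0 "\<lambda>k. (1 - s) * p 0"] by (intro sums_add sums_mult assms(2)) auto
    then show ?thesis by (simp add: sums_iff)
  qed
  also have "\<dots> < s + (1 - s) * 1"
    using assms by (intro add_strict_left_mono mult_strict_left_mono) auto
  finally show ?thesis by simp
qed

text \<open>The graph lies above its tangent at 1, which is the diagonal because the mean is 1;
  termwise this is Bernoulli's inequality.\<close>

lemma critical_pgf_ge:
  fixes p :: "nat \<Rightarrow> real"
  assumes "\<And>k. p k \<ge> 0" "p sums 1" "(\<lambda>k. real k * p k) sums 1" "0 \<le> s" "s \<le> 1"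
  shows "s \<le> (\<Sum>k. p k * s ^ k)"
proof -
  have "(\<lambda>k. p k + (real k * p k) * (s - 1)) sums (1 + 1 * (s - 1))"
    by (intro sums_add sums_mult2 assms)
  then have 1: "(\<lambda>k. p k * (1 + real k * (s - 1))) sums s"
    by (simp add: algebra_simps)
  have "summable (\<lambda>k. p k * s ^ k)"
    using assms by (intro summable_comparison_test'[OF sums_summable[OF assms(2)], of 0])
      (auto simp: abs_mult power_abs intro!: mult_left_le power_le_one)
  moreover have "p k * (1 + real k * (s - 1)) \<le> p k * s ^ k" for k
    using Bernoulli_inequality[of "s - 1" k] assms by (intro mult_left_mono) auto
  ultimately show ?thesis
    using suminf_le[of "\<lambda>k. p k * (1 + real k * (s - 1))" "\<lambda>k. p k * s ^ k"] 1
    by (simp add: sums_iff)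
qed

text \<open>The Stolz-Cesaro theorem with denominators \<open>n\<close>: from \<open>N\<close> on
  each increment deviates from \<open>l\<close> by less than \<open>e / 2\<close>, and the
  contribution of the first \<open>N\<close> terms vanishes after division by
  \<open>n\<close>.\<close>

lemma difference_tendsto_imp_ratio_tendsto:
  fixes a :: "nat \<Rightarrow> real"
  assumes "(\<lambda>n. a (Suc n) - a n) \<longlonglongrightarrow> l"
  shows "(\<lambda>n. a n / real n) \<longlonglongrightarrow> l"
proof (rule LIMSEQ_I)
  fix e :: real assume e: "e > 0"
  obtain N where N: "\<And>n. n \<ge> N \<Longrightarrow> \<bar>a (Suc n) - a n - l\<bar> < e / 2"
    using LIMSEQ_D[OF assms, of "e / 2"] e by auto
  have dev: "\<bar>a (N + k) - a N - l * real k\<bar> \<le> e / 2 * real k" for k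
  proof (induction k)
    case (Suc k)
    have "a (N + Suc k) - a N - l * real (Suc k)
        = (a (Suc (N + k)) - a (N + k) - l) + (a (N + k) - a N - l * real k)"
      by (simp add: algebra_simps)
    then have "\<bar>a (N + Suc k) - a N - l * real (Suc k)\<bar> \<le> e / 2 + e / 2 * real k"
      using N[of "N + k"] Suc by linarith
    then show ?case by (simp add: algebra_simps)
  qed simp
  have "(\<lambda>n. (\<bar>a N\<bar> + (\<bar>l\<bar> + e) * real N) / real n) \<longlonglongrightarrow> 0"
    by (rule lim_const_over_n)
  then obtain K where K: "\<And>n. n \<ge> K \<Longrightarrow> (\<bar>a N\<bar> + (\<bar>l\<bar> + e) * real N) / real n < e / 2"
    using LIMSEQ_D[of _ 0 "e / 2"] e by (metis diff_zero half_gt_zero norm_of_real of_real_eq_id id_apply real_norm_def abs_less_iff)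
  show "\<exists>no. \<forall>n\<ge>no. norm (a n / real n - l) < e"
  proof (intro exI allI impI)
    fix n assume n: "n \<ge> max (max N K) 1"
    define k where "k = n - N"
    have nk: "n = N + k" using n by (simp add: k_def)
    have "\<bar>a n - l * real n\<bar> \<le> \<bar>a n - a N - l * real k\<bar> + (\<bar>a N\<bar> + \<bar>l\<bar> * real N)"
      using abs_mult[of l "real N"] by (simp add: nk algebra_simps)
    also have "\<dots> \<le> e / 2 * real n + (\<bar>a N\<bar> + (\<bar>l\<bar> + e) * real N)"
    proof -
      have "e / 2 * real n = e / 2 * real N + e / 2 * real k" "(\<bar>l\<bar> + e) * real N = \<bar>l\<bar> * real N + e * real N"
        "e / 2 * real N \<ge> 0" "e * real N \<ge> 0"
        using e by (auto simp: nk algebra_simps)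
      then show ?thesis using dev[of k] unfolding nk by linarith
    qed
    also have "\<dots> < e / 2 * real n + e / 2 * real n"
      using K[of n] n e by (simp add: field_simps)
    finally have "\<bar>a n - l * real n\<bar> < e * real n" by simp
    moreover have "a n / real n - l = (a n - l * real n) / real n" using n by (simp add: field_simps)
    ultimately show "norm (a n / real n - l) < e" using n by (simp add: field_simps abs_divide)
  qed
qed

section \<open>Decay of an iteration whose decrement is convex and regularly varying\<close>

locale critical_iteration =
  fixes \<phi> :: "real \<Rightarrow> real" and \<beta> :: real and q :: "nat \<Rightarrow> real"
  assumes beta: "\<beta> > 0"
    and convex: "convex_on {0..1} \<phi>"
    and zero: "\<phi> 0 = 0"
    and nonneg: "0 \<le> u \<Longrightarrow> u \<le> 1 \<Longrightarrow> 0 \<le> \<phi> u"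
    and ratio: "0 < x \<Longrightarrow> x \<le> 1 \<Longrightarrow> ((\<lambda>s. \<phi> (s * x) / \<phi> s) \<longlongrightarrow> x powr (1 + \<beta>)) (at_right 0)"
    and q_pos: "q n > 0"
    and q_le_1: "q n \<le> 1"
    and q_Suc: "q (Suc n) = q n - \<phi> (q n)"
begin

definition g :: "real \<Rightarrow> real" where "g u = \<phi> u / u"

text \<open>\<open>g u\<close> is the slope of the chord from the origin to the graph of the convex
  function \<open>\<phi>\<close>.\<close>

lemma g_mono: "0 < u \<Longrightarrow> u \<le> v \<Longrightarrow> v \<le> 1 \<Longrightarrow> g u \<le> g v"
  using convex_on_slope_le(1)[OF convex, of 0 v u] zero by (cases "u = v") (auto simp: g_def)

text \<open>Already \<open>ratio\<close> at \<open>x = 1\<close> has content: where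
  \<open>\<phi> s = 0\<close> the quotient is 0 by the convention for division, so its limit 1 makes
  \<open>\<phi>\<close> nonzero close to 0. Monotonicity of \<open>g\<close> carries positivity to
  the whole interval.\<close>

lemma phi_pos: assumes "0 < u" "u \<le> 1" shows "\<phi> u > 0"
proof -
  have "eventually (\<lambda>s. \<phi> (s * 1) / \<phi> s > 1/2) (at_right 0)"
    using order_tendstoD(1)[OF ratio[of 1], of "1/2"] by auto
  moreover have "eventually (\<lambda>s. s < u) (at_right (0::real))"
    using assms(1) eventually_at_right[of 0 u] by auto
  ultimately have "eventually (\<lambda>s. \<phi> s \<noteq> 0 \<and> 0 < s \<and> s < u) (at_right 0)"
    using eventually_at_right_less[of 0] by eventually_elim auto
  then obtain s where s: "\<phi> s \<noteq> 0" "0 < s" "s < u"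
    by (metis (mono_tags, lifting) eventually_happens trivial_limit_at_right_real)
  then have "0 < g s" using nonneg[of s] assms by (auto simp: g_def less_le)
  also have "\<dots> \<le> g u" using s assms by (intro g_mono) auto
  finally show ?thesis using assms by (simp add: g_def zero_less_divide_iff)
qed

lemma g_pos: "0 < u \<Longrightarrow> u \<le> 1 \<Longrightarrow> g u > 0"
  by (simp add: g_def phi_pos)

lemma q_antimono: "decseq q"
  using phi_pos q_pos q_le_1 by (intro decseq_SucI) (simp add: q_Suc less_imp_le)

text \<open>At a positive limit \<open>l\<close> every step would decrease \<open>q\<close> by at
  least \<open>l * g l\<close>, a fixed positive amount.\<close>

lemma q_tendsto_0: "q \<longlonglongrightarrow> 0"
proof -
  obtain l where l: "q \<longlonglongrightarrow> l" "\<And>n. l \<le> q n"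
    using decseq_convergent[OF q_antimono, of 0] q_pos less_imp_le by blast
  have "l \<ge> 0" using l(1) q_pos by (intro LIMSEQ_le_const) (auto intro: less_imp_le)
  moreover have "\<not> l > 0"
  proof
    assume "l > 0"
    then have l1: "l \<le> 1" using l(2)[of 0] q_le_1[of 0] by linarith
    have "(\<lambda>n. q n - q (Suc n)) \<longlonglongrightarrow> l - l" by (intro tendsto_diff l(1) LIMSEQ_Suc)
    moreover have "l * g l \<le> q n - q (Suc n)" for n
    proof -
      have "l * g l \<le> q n * g (q n)"
        using \<open>l > 0\<close> l(2)[of n] q_le_1[of n] g_pos[OF \<open>l > 0\<close> l1] by (intro mult_mono g_mono) auto
      then show ?thesis using q_pos[of n] by (simp add: g_def q_Suc)
    qed
    ultimately have "l * g l \<le> l - l" by (intro LIMSEQ_le_const) auto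
    then show False using \<open>l > 0\<close> g_pos[OF \<open>l > 0\<close> l1] by (simp add: mult_le_0_iff)
  qed
  ultimately show ?thesis using l(1) by simp
qed

lemma q_at_right_0: "filterlim q (at_right 0) sequentially"
  using q_tendsto_0 q_pos by (auto simp: filterlim_at less_imp_neq[symmetric])

text \<open>Factors above 1, outside the range of \<open>ratio\<close>, are reached by applying it
  with \<open>1 / x\<close> along \<open>x * q n\<close> and inverting. They supply the chords to
  the right of \<open>q n\<close>.\<close>

lemma ratio_q:
  assumes "0 < x" shows "(\<lambda>n. \<phi> (x * q n) / \<phi> (q n)) \<longlonglongrightarrow> x powr (1 + \<beta>)"
proof (cases "x \<le> 1")
  case True
  then show ?thesis
    using filterlim_compose[OF ratio[OF assms] q_at_right_0] by (simp add: mult.commute)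
next
  case False
  have "filterlim (\<lambda>n. x * q n) (at_right 0) sequentially"
    using tendsto_mult_left[OF q_tendsto_0, of x] q_pos assms by (auto simp: filterlim_at less_imp_neq[symmetric])
  from filterlim_compose[OF ratio[of "1 / x"] this] False
  have "(\<lambda>n. \<phi> (q n) / \<phi> (x * q n)) \<longlonglongrightarrow> (1 / x) powr (1 + \<beta>)" by simp
  then have "(\<lambda>n. inverse (\<phi> (q n) / \<phi> (x * q n))) \<longlonglongrightarrow> inverse ((1 / x) powr (1 + \<beta>))"
    using assms by (intro tendsto_inverse) auto
  then show ?thesis using assms by (simp add: powr_divide)
qed

text \<open>If the monotone limit \<open>l\<close> were positive, then \<open>g (q n / 2)\<close>,
  being at least \<open>l\<close>, would asymptotically be no smaller than \<open>g (q n)\<close>.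
  Regular variation gives their quotient the limit \<open>2 powr (- \<beta>)\<close>, which is below
  1.\<close>

lemma g_q_tendsto_0: "(\<lambda>n. g (q n)) \<longlonglongrightarrow> 0"
proof -
  have dec: "decseq (\<lambda>n. g (q n))"
    using q_antimono q_pos q_le_1 by (auto simp: decseq_def intro!: g_mono)
  obtain l where l: "(\<lambda>n. g (q n)) \<longlonglongrightarrow> l" "\<And>n. l \<le> g (q n)"
    using decseq_convergent[OF dec, of 0] g_pos[OF q_pos q_le_1] less_imp_le by blast
  have "l \<ge> 0"
    using l(1) g_pos[OF q_pos q_le_1] by (intro LIMSEQ_le_const) (auto intro: less_imp_le)
  moreover have "\<not> l > 0"
  proof
    assume "l > 0"
    have le: "l / g (q n) \<le> 2 * (\<phi> (1/2 * q n) / \<phi> (q n))" for n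
    proof -
      have "eventually (\<lambda>m. q m < q n / 2) sequentially"
        using q_tendsto_0 q_pos[of n] by (intro order_tendstoD) auto
      then obtain m where m: "q m < q n / 2" by (auto simp: eventually_sequentially)
      have "l \<le> g (q m)" by fact
      also have "\<dots> \<le> g (q n / 2)" using m q_pos[of m] q_le_1[of n] by (intro g_mono) auto
      finally have "l / g (q n) \<le> g (q n / 2) / g (q n)"
        using g_pos[OF q_pos q_le_1, of n] by (intro divide_right_mono) auto
      then show ?thesis using q_pos[of n] phi_pos[OF q_pos q_le_1, of n] by (simp add: g_def field_simps)
    qed
    have "(\<lambda>n. l / g (q n)) \<longlonglongrightarrow> l / l" using \<open>l > 0\<close> by (intro tendsto_divide l tendsto_const) auto
    moreover have "(\<lambda>n. 2 * (\<phi> (1/2 * q n) / \<phi> (q n))) \<longlonglongrightarrow> 2 * (1/2) powr (1 + \<beta>)"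
      by (intro tendsto_mult_left ratio_q) auto
    ultimately have "l / l \<le> 2 * (1/2) powr (1 + \<beta>)" by (rule LIMSEQ_le) (use le in blast)
    moreover have "(1/2) powr (1 + \<beta>) < (1/2 :: real) powr 1"
      using beta by (intro powr_less_mono') auto
    ultimately show False using \<open>l > 0\<close> by simp
  qed
  ultimately show ?thesis using l(1) by simp
qed

definition slope :: "nat \<Rightarrow> real" where
  "slope n = (\<phi> (q n) - \<phi> (q (Suc n))) / (q n - q (Suc n))"

lemma powr_difference_quotient:
  "((\<lambda>x. (x powr (1 + \<beta>) - 1) / (x - 1)) \<longlongrightarrow> 1 + \<beta>) (at (1::real))"
proof -
  have "((\<lambda>x. x powr (1 + \<beta>)) has_real_derivative (1 + \<beta>) * 1 powr (1 + \<beta> - 1)) (at 1)"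
    by (intro has_real_derivative_powr) auto
  then show ?thesis by (simp add: has_field_derivative_iff)
qed

text \<open>By convexity the slope over the last step lies between the slopes of the chords from
  \<open>q n\<close> to \<open>x q n\<close> with \<open>x < 1\<close> and with \<open>x > 1\<close>; regular variation gives their limits.\<close>

lemma slope_ratio_tendsto: "(\<lambda>n. slope n / g (q n)) \<longlonglongrightarrow> 1 + \<beta>"
proof (rule order_tendstoI)
  let ?c = "\<lambda>x. (x powr (1 + \<beta>) - 1) / (x - 1)"
  let ?C = "\<lambda>x n. (\<phi> (x * q n) / \<phi> (q n) - 1) / (x - 1)"
  have lim: "?C x \<longlonglongrightarrow> ?c x" if "0 < x" "x \<noteq> 1" for x
    using that by (intro tendsto_intros ratio_q) auto
  have step: "q (Suc n) < q n" for n using phi_pos[OF q_pos q_le_1, of n] by (simp add: q_Suc)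
  have C: "((\<phi> (x * q n) - \<phi> (q n)) / (x * q n - q n)) / g (q n) = ?C x n" if "x \<noteq> 1" for x n
  proof -
    have "x * q n - q n = (x - 1) * q n" by (simp add: algebra_simps)
    then show ?thesis using that q_pos[of n] phi_pos[OF q_pos q_le_1, of n]
      by (simp add: g_def divide_simps)
  qed
  {
    fix a assume a: "a < 1 + \<beta>"
    have "eventually (\<lambda>x. a < ?c x) (at_left 1)"
      using order_tendstoD(1)[OF powr_difference_quotient a] by (simp add: eventually_at_split)
    moreover have "eventually (\<lambda>x::real. 0 < x \<and> x < 1) (at_left 1)"
      by (auto simp: eventually_at_left[of 0] intro: exI[of _ 0])
    ultimately obtain x where x: "a < ?c x" "0 < x" "x < 1"
      by (metis (mono_tags, lifting) eventually_conj eventually_happens trivial_limit_at_left_real)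
    have "eventually (\<lambda>n. a < ?C x n) sequentially"
      using order_tendstoD(1)[OF lim[of x]] x by auto
    \<comment> \<open>The next iterate is \<open>q n * (1 - g (q n))\<close>, so this places
      \<open>x * q n\<close> to its left, as the comparison of chords requires.\<close>
    moreover have "eventually (\<lambda>n. g (q n) < 1 - x) sequentially"
      using order_tendstoD(2)[OF g_q_tendsto_0, of "1 - x"] x by auto
    ultimately show "eventually (\<lambda>n. a < slope n / g (q n)) sequentially"
    proof eventually_elim
      case (elim n)
      have "x * q n < q (Suc n)"
        using elim(2) q_pos[of n] by (simp add: q_Suc g_def field_simps)
      then have "(\<phi> (x * q n) - \<phi> (q n)) / (x * q n - q n) \<le> (\<phi> (q (Suc n)) - \<phi> (q n)) / (q (Suc n) - q n)"
        using x q_pos[of n] q_le_1[of n] step[of n] mult_left_le_one_le[of "q n" x]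
        by (intro convex_on_slope_le(2)[OF convex]) auto
      also have "\<dots> = slope n" unfolding slope_def by (metis minus_diff_eq minus_divide_divide)
      finally have "?C x n \<le> slope n / g (q n)"
        using divide_right_mono[OF _ less_imp_le[OF g_pos[OF q_pos q_le_1]]] C x by (metis less_irrefl)
      then show ?case using elim by linarith
    qed
  }
  {
    fix a assume a: "1 + \<beta> < a"
    have "eventually (\<lambda>x. ?c x < a) (at_right 1)"
      using order_tendstoD(2)[OF powr_difference_quotient a] by (simp add: eventually_at_split)
    moreover have "eventually (\<lambda>x::real. 1 < x \<and> x < 2) (at_right 1)"
      by (auto simp: eventually_at_right[of 1 2] intro: exI[of _ 2])
    ultimately obtain x where x: "?c x < a" "1 < x"
      by (metis (mono_tags, lifting) eventually_conj eventually_happens trivial_limit_at_right_real)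
    have "eventually (\<lambda>n. ?C x n < a) sequentially"
      using order_tendstoD(2)[OF lim[of x]] x by auto
    \<comment> \<open>Keeps \<open>x * q n\<close> inside the interval on which
      \<open>\<phi>\<close> is convex.\<close>
    moreover have "eventually (\<lambda>n. q n < 1 / x) sequentially"
      using order_tendstoD(2)[OF q_tendsto_0, of "1 / x"] x by auto
    ultimately show "eventually (\<lambda>n. slope n / g (q n) < a) sequentially"
    proof eventually_elim
      case (elim n)
      have x1: "x * q n \<le> 1" using elim(2) x by (simp add: field_simps)
      have qx: "q n < x * q n" using x q_pos[of n] by simp
      have I: "q (Suc n) \<in> {0..1}" "x * q n \<in> {0..1}"
        using q_pos[of "Suc n"] q_le_1[of "Suc n"] x1 x q_pos[of n] by auto
      have "slope n = (\<phi> (q (Suc n)) - \<phi> (q n)) / (q (Suc n) - q n)"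
        unfolding slope_def by (metis minus_diff_eq minus_divide_divide)
      also have "\<dots> \<le> (\<phi> (q (Suc n)) - \<phi> (x * q n)) / (q (Suc n) - x * q n)"
        using step[of n] qx by (intro convex_on_slope_le(1)[OF convex I]) auto
      also have "\<dots> \<le> (\<phi> (q n) - \<phi> (x * q n)) / (q n - x * q n)"
        using step[of n] qx by (intro convex_on_slope_le(2)[OF convex I]) auto
      also have "\<dots> = (\<phi> (x * q n) - \<phi> (q n)) / (x * q n - q n)"
        by (metis minus_diff_eq minus_divide_divide)
      finally have "slope n / g (q n) \<le> ?C x n"
        using divide_right_mono[OF _ less_imp_le[OF g_pos[OF q_pos q_le_1]]] C x by (metis less_irrefl)
      then show ?case using elim by linarith
    qed
  }
qed

lemma g_q_asymp: "(\<lambda>n. real n * g (q n)) \<longlonglongrightarrow> 1 / \<beta>"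
proof -
  have gq: "g (q n) > 0" for n by (rule g_pos[OF q_pos q_le_1])
  have aux: "(s / u - 1) / (1 - s) = (1 - u) / (u * (1 - s)) - 1 / u"
    if "0 < u" "s < 1" for s u :: real
    using that by (simp add: field_simps)
  have s0: "slope \<longlonglongrightarrow> 0"
    using tendsto_mult[OF slope_ratio_tendsto g_q_tendsto_0] gq by (simp add: less_imp_neq[symmetric])
  have "(\<lambda>n. (slope n / g (q n) - 1) / (1 - slope n)) \<longlonglongrightarrow> (1 + \<beta> - 1) / (1 - 0)"
    by (intro tendsto_intros slope_ratio_tendsto s0) auto
  moreover have "eventually (\<lambda>n. (slope n / g (q n) - 1) / (1 - slope n)
      = 1 / g (q (Suc n)) - 1 / g (q n)) sequentially"
    using order_tendstoD(2)[OF s0, of 1] 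
  proof (rule eventually_mono)
    show "(0::real) < 1" by simp
    fix n assume s: "slope n < 1"
    have "slope n * (q n * g (q n)) = \<phi> (q n) - \<phi> (q (Suc n))"
      using q_pos[of n] phi_pos[OF q_pos q_le_1, of n] by (simp add: slope_def g_def q_Suc)
    moreover have phi: "\<phi> (q m) = q m * g (q m)" for m using q_pos[of m] by (simp add: g_def)
    moreover have qS: "q (Suc n) = q n * (1 - g (q n))"
      using phi[of n] by (simp add: q_Suc algebra_simps)
    ultimately have "slope n * (q n * g (q n)) = q n * g (q n) - q n * (1 - g (q n)) * g (q (Suc n))"
      by metis
    then have "q n * ((1 - g (q n)) * g (q (Suc n))) = q n * (g (q n) * (1 - slope n))"
      by (simp add: algebra_simps)
    \<comment> \<open>The definition of \<open>slope\<close> with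
      \<open>q (Suc n) = q n * (1 - g (q n))\<close> inserted and \<open>q n\<close> cancelled: a
      recursion for \<open>g (q n)\<close> in which only the slope remains.\<close>
    then have e: "(1 - g (q n)) * g (q (Suc n)) = g (q n) * (1 - slope n)" using q_pos[of n] by simp
    have "1 / g (q (Suc n)) = (1 - g (q n)) / (g (q n) * (1 - slope n))"
      using gq[of "Suc n"] s gq[of n] unfolding e[symmetric] 
      by (metis e divide_eq_0_iff mult_eq_0_iff nonzero_divide_mult_cancel_left diff_gt_0_iff_gt less_irrefl)
    then show "(slope n / g (q n) - 1) / (1 - slope n) = 1 / g (q (Suc n)) - 1 / g (q n)"
      using aux[OF gq[of n] s] by simp
  qed
  ultimately have "(\<lambda>n. 1 / g (q (Suc n)) - 1 / g (q n)) \<longlonglongrightarrow> \<beta>"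
    using tendsto_cong by fastforce
  from difference_tendsto_imp_ratio_tendsto[OF this]
  have "(\<lambda>n. inverse (1 / g (q n) / real n)) \<longlonglongrightarrow> inverse \<beta>"
    using beta by (intro tendsto_inverse) auto
  then show ?thesis by (simp add: field_simps)
qed

lemma eventually_index_le:
  assumes "\<kappa> > \<beta>" shows "eventually (\<lambda>n. 1 \<le> \<kappa> * (real n * g (q n))) sequentially"
proof -
  have "1 / \<kappa> < 1 / \<beta>" using assms beta by (simp add: field_simps)
  from order_tendstoD(1)[OF g_q_asymp this] show ?thesis
    by eventually_elim (use assms beta in \<open>auto simp: field_simps\<close>)
qed

text \<open>A Potter type estimate. For \<open>k\<close> between \<beta> and \<kappa> the product
  \<open>n * q n powr k\<close> is eventually nonincreasing: its first factor grows by at most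
  \<open>exp (1 / n)\<close>, its second shrinks by at least \<open>exp (- k * g (q n))\<close>, and
  \<open>1 / n \<le> k * g (q n)\<close>. The spare power of \<open>q n\<close> then gives the limit
  0.\<close>

lemma index_times_powr_tendsto_0:
  assumes "\<kappa> > \<beta>" shows "(\<lambda>n. real n * q n powr \<kappa>) \<longlonglongrightarrow> 0"
proof -
  define k where "k = (\<kappa> + \<beta>) / 2"
  have k: "k > \<beta>" "\<kappa> > k" using assms by (auto simp: k_def)
  obtain N where N: "\<And>n. n \<ge> N \<Longrightarrow> 1 \<le> k * (real n * g (q n))"
    using eventually_index_le[OF k(1)] by (auto simp: eventually_sequentially)
  define B where "B = real (max N 1) * q (max N 1) powr k"
  have bound: "real n * q n powr k \<le> B" if "n \<ge> max N 1" for n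
    using that
  proof (induction n rule: dec_induct)
    case base
    show ?case by (simp add: B_def)
  next
    case (step n)
    then have n: "n > 0" "n \<ge> N" by auto
    have "real (Suc n) = real n * (1 + 1 / real n)" using n by (simp add: field_simps)
    also have "\<dots> \<le> real n * exp (1 / real n)" by (intro mult_left_mono exp_ge_add_one_self) auto
    also have "1 / real n \<le> k * g (q n)" using N[OF n(2)] n(1) by (simp add: field_simps)
    finally have 1: "real (Suc n) \<le> real n * exp (k * g (q n))" by (simp add: mult_left_mono)
    have "q (Suc n) = q n * (1 - g (q n))" using q_pos[of n] by (simp add: q_Suc g_def algebra_simps)
    also have "\<dots> \<le> q n * exp (- g (q n))"
      using q_pos[of n] exp_ge_add_one_self[of "- g (q n)"] by (intro mult_left_mono) auto
    finally have "q (Suc n) powr k \<le> (q n * exp (- g (q n))) powr k"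
      using q_pos[of "Suc n"] k beta by (intro powr_mono2) auto
    also have "\<dots> = q n powr k * exp (- (k * g (q n)))"
      using q_pos[of n] by (simp add: powr_mult powr_def[of "exp _"])
    finally have "real (Suc n) * q (Suc n) powr k
        \<le> (real n * exp (k * g (q n))) * (q n powr k * exp (- (k * g (q n))))"
      by (intro mult_mono 1) auto
    also have "\<dots> = real n * q n powr k" by (simp add: exp_minus)
    finally show ?case using step.IH by simp
  qed
  have "(\<lambda>n. q n powr (\<kappa> - k)) \<longlonglongrightarrow> 0 powr (\<kappa> - k)"
    using k by (intro tendsto_powr' q_tendsto_0 tendsto_const) (auto intro!: always_eventually less_imp_le q_pos)
  then have "(\<lambda>n. B * q n powr (\<kappa> - k)) \<longlonglongrightarrow> 0" using tendsto_mult_right_zero by fastforce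
  moreover have "eventually (\<lambda>n. real n * q n powr \<kappa> \<le> B * q n powr (\<kappa> - k)) sequentially"
    using eventually_ge_at_top[of "max N 1"]
  proof eventually_elim
    case (elim n)
    have "q n powr \<kappa> = q n powr k * q n powr (\<kappa> - k)" by (simp add: powr_add[symmetric])
    then show ?case using mult_right_mono[OF bound[OF elim], of "q n powr (\<kappa> - k)"] by (simp add: mult.assoc)
  qed
  ultimately show ?thesis
    by (rule_tac tendsto_sandwich[OF always_eventually _ tendsto_const]) simp_all
qed

end

section \<open>Tails of sums of independent variables\<close>

text \<open>The Taylor remainder is at most both \<open>\<bar>u\<bar> * exp t\<close> and
  \<open>u\<^sup>2 * exp t\<close>, and \<open>\<bar>u\<bar> powr \<kappa>\<close> dominates the
  first factor for large \<open>u\<close> and the second for small \<open>u\<close>. Only an upper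
  bound on \<open>u\<close> is assumed, which fits truncation from above.\<close>

lemma exp_le_powr_remainder:
  fixes u t \<kappa> :: real
  assumes "u \<le> t" "0 \<le> t" "1 \<le> \<kappa>" "\<kappa> \<le> 2"
  shows "exp u \<le> 1 + u + \<bar>u\<bar> powr \<kappa> * exp t"
proof -
  have "exp u - 1 - u \<le> \<bar>u\<bar> * exp t \<and> exp u - 1 - u \<le> u\<^sup>2 * exp t"
  proof (cases "u \<ge> 0")
    case True
    have "1 - u \<le> exp (- u)" using exp_ge_add_one_self[of "- u"] by simp
    then have "(1 - u) * exp u \<le> exp (- u) * exp u" by (intro mult_right_mono) auto
    then have 1: "exp u - 1 \<le> u * exp u" by (simp add: exp_minus algebra_simps)
    have "exp u - 1 - u \<le> u * (exp u - 1)" using 1 by (simp add: algebra_simps)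
    also have "\<dots> \<le> u * (u * exp u)" using 1 True by (intro mult_left_mono) auto
    finally have 2: "exp u - 1 - u \<le> u\<^sup>2 * exp u" by (simp add: power2_eq_square)
    have "u * exp u \<le> u * exp t" "u\<^sup>2 * exp u \<le> u\<^sup>2 * exp t"
      using assms True by (auto intro!: mult_left_mono)
    then show ?thesis using 1 2 True by auto
  next
    case False
    have "exp (- u) \<ge> 1 - u" using exp_ge_add_one_self[of "- u"] by simp
    then have "exp u \<le> 1 / (1 - u)" using False by (simp add: exp_minus field_simps)
    also have "\<dots> \<le> 1 + u + u\<^sup>2"
    proof -
      have "(1 + u + u\<^sup>2) * (1 - u) = 1 + u\<^sup>2 * (- u)" by (simp add: algebra_simps power2_eq_square)
      also have "\<dots> \<ge> 1" using False by (auto intro!: mult_nonneg_nonpos)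
      finally show ?thesis using False by (simp add: field_simps)
    qed
    finally have "exp u - 1 - u \<le> u\<^sup>2" by simp
    moreover have "exp u - 1 - u \<le> \<bar>u\<bar>" using False by simp
    moreover have "\<bar>u\<bar> * 1 \<le> \<bar>u\<bar> * exp t" "u\<^sup>2 * 1 \<le> u\<^sup>2 * exp t"
      using assms by (auto intro!: mult_left_mono simp del: mult_1_right)
    ultimately show ?thesis by linarith
  qed
  moreover have "\<bar>u\<bar> \<le> \<bar>u\<bar> powr \<kappa> \<or> u\<^sup>2 \<le> \<bar>u\<bar> powr \<kappa>"
  proof (cases "\<bar>u\<bar> \<le> 1")
    case True
    then show ?thesis using powr_mono'[of \<kappa> 2 "\<bar>u\<bar>"] assms by (cases "u = 0") auto
  next
    case False
    then show ?thesis using powr_mono[of 1 \<kappa> "\<bar>u\<bar>"] assms by auto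
  qed
  ultimately have "exp u - 1 - u \<le> \<bar>u\<bar> powr \<kappa> * exp t"
    by (meson exp_ge_zero mult_right_mono order_trans)
  then show ?thesis by simp
qed

context prob_space
begin

text \<open>A Fuk--Nagaev type inequality. Truncating from above only makes the mean of a summand
  nonpositive, so the truncated exponential moment has no first order term.\<close>

lemma truncated_sum_tail:
  fixes X :: "'i \<Rightarrow> 'a \<Rightarrow> real"
  assumes fin: "finite I" and indep: "indep_vars (\<lambda>_. borel) X I"
    and int: "\<And>i. i \<in> I \<Longrightarrow> integrable M (X i)" and mean: "\<And>i. i \<in> I \<Longrightarrow> expectation (X i) = 0"
    and k_int: "\<And>i. i \<in> I \<Longrightarrow> integrable M (\<lambda>\<omega>. \<bar>X i \<omega>\<bar> powr \<kappa>)"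
    and k_le: "\<And>i. i \<in> I \<Longrightarrow> expectation (\<lambda>\<omega>. \<bar>X i \<omega>\<bar> powr \<kappa>) \<le> m"
    and tail: "\<And>i. i \<in> I \<Longrightarrow> prob {\<omega> \<in> space M. X i \<omega> > t} \<le> v"
    and par: "0 < t" "0 < \<theta>" "1 \<le> \<kappa>" "\<kappa> \<le> 2"
  shows "prob {\<omega> \<in> space M. x \<le> (\<Sum>i\<in>I. X i \<omega>)}
    \<le> real (card I) * v + exp (- \<theta> * x + real (card I) * (\<theta> powr \<kappa> * exp (\<theta> * t) * m))"
proof -
  define X' where "X' i \<omega> = (if X i \<omega> \<le> t then X i \<omega> else 0)" for i \<omega>
  have [measurable]: "X i \<in> borel_measurable M" if "i \<in> I" for i using int[OF that] by simp
  have [measurable]: "X' i \<in> borel_measurable M" if "i \<in> I" for i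
    using that unfolding X'_def by measurable
  have X'_le: "X' i \<omega> \<le> t" "X' i \<omega> \<le> X i \<omega>" "\<bar>X' i \<omega>\<bar> \<le> \<bar>X i \<omega>\<bar>" for i \<omega>
    using par by (auto simp: X'_def)
  have X'_int: "integrable M (X' i)" if "i \<in> I" for i
    using that X'_le by (intro Bochner_Integration.integrable_bound[OF int[OF that]]) auto
  have X'_k: "integrable M (\<lambda>\<omega>. \<bar>X' i \<omega>\<bar> powr \<kappa>)" if "i \<in> I" for i
    using that X'_le par by (intro Bochner_Integration.integrable_bound[OF k_int[OF that]])
      (auto intro!: powr_mono2)
  have E_int: "integrable M (\<lambda>\<omega>. exp (\<theta> * X' i \<omega>))" if "i \<in> I" for i
    using that X'_le par by (intro integrable_const_bound[where B = "exp (\<theta> * t)"]) auto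
  let ?e = "\<theta> powr \<kappa> * exp (\<theta> * t) * m"
  have E_le: "expectation (\<lambda>\<omega>. exp (\<theta> * X' i \<omega>)) \<le> exp ?e" if i: "i \<in> I" for i
  proof -
    have "expectation (\<lambda>\<omega>. exp (\<theta> * X' i \<omega>))
        \<le> expectation (\<lambda>\<omega>. 1 + \<theta> * X' i \<omega> + \<theta> powr \<kappa> * exp (\<theta> * t) * \<bar>X' i \<omega>\<bar> powr \<kappa>)"
    proof (intro integral_mono E_int i Bochner_Integration.integrable_add integrable_mult_right X'_int X'_k)
      fix \<omega>
      have "exp (\<theta> * X' i \<omega>) \<le> 1 + \<theta> * X' i \<omega> + \<bar>\<theta> * X' i \<omega>\<bar> powr \<kappa> * exp (\<theta> * t)"
        using par X'_le by (intro exp_le_powr_remainder) auto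
      then show "exp (\<theta> * X' i \<omega>) \<le> 1 + \<theta> * X' i \<omega> + \<theta> powr \<kappa> * exp (\<theta> * t) * \<bar>X' i \<omega>\<bar> powr \<kappa>"
        using par by (simp add: abs_mult powr_mult mult_ac)
    qed auto
    also have "\<dots> = 1 + \<theta> * expectation (X' i)
        + \<theta> powr \<kappa> * exp (\<theta> * t) * expectation (\<lambda>\<omega>. \<bar>X' i \<omega>\<bar> powr \<kappa>)"
      using X'_int[OF i] X'_k[OF i] by (simp add: prob_space)
    also have "\<dots> \<le> 1 + 0 + ?e"
    proof (intro add_mono mult_left_mono order_refl)
      have "expectation (X' i) \<le> expectation (X i)"
        by (intro integral_mono int X'_int i X'_le)
      then show "\<theta> * expectation (X' i) \<le> 0" using par mean[OF i] by (simp add: mult_le_0_iff)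
      have "expectation (\<lambda>\<omega>. \<bar>X' i \<omega>\<bar> powr \<kappa>) \<le> expectation (\<lambda>\<omega>. \<bar>X i \<omega>\<bar> powr \<kappa>)"
        using par X'_le by (intro integral_mono X'_k k_int i powr_mono2) auto
      then show "expectation (\<lambda>\<omega>. \<bar>X' i \<omega>\<bar> powr \<kappa>) \<le> m" using k_le[OF i] by linarith
    qed auto
    also have "\<dots> \<le> exp ?e" using exp_ge_add_one_self[of ?e] by simp
    finally show ?thesis .
  qed
  have ind': "indep_vars (\<lambda>_. borel) (\<lambda>i \<omega>. exp (\<theta> * X' i \<omega>)) I"
    unfolding X'_def by (intro indep_vars_compose2[OF indep]) auto
  have P_int: "integrable M (\<lambda>\<omega>. \<Prod>i\<in>I. exp (\<theta> * X' i \<omega>))"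
    by (intro indep_vars_integrable fin ind' E_int)
  have P_le: "expectation (\<lambda>\<omega>. \<Prod>i\<in>I. exp (\<theta> * X' i \<omega>)) \<le> exp (real (card I) * ?e)"
  proof -
    have "expectation (\<lambda>\<omega>. \<Prod>i\<in>I. exp (\<theta> * X' i \<omega>)) = (\<Prod>i\<in>I. expectation (\<lambda>\<omega>. exp (\<theta> * X' i \<omega>)))"
      by (intro indep_vars_lebesgue_integral fin ind' E_int)
    also have "\<dots> \<le> (\<Prod>i\<in>I. exp ?e)" by (intro prod_mono conjI E_le) auto
    finally show ?thesis by (simp add: exp_of_nat_mult)
  qed
  \<comment> \<open>If no summand exceeds \<open>t\<close>, truncation changes nothing and a large
    sum makes the exponential product large. The union bound treats the first event, Markov's
    inequality the second.\<close>
  have "{\<omega> \<in> space M. x \<le> (\<Sum>i\<in>I. X i \<omega>)}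
      \<subseteq> (\<Union>i\<in>I. {\<omega> \<in> space M. X i \<omega> > t}) \<union> {\<omega> \<in> space M. exp (\<theta> * x) \<le> (\<Prod>i\<in>I. exp (\<theta> * X' i \<omega>))}"
  proof (rule subsetI, rule UnCI)
    fix \<omega> assume w: "\<omega> \<in> {\<omega> \<in> space M. x \<le> (\<Sum>i\<in>I. X i \<omega>)}"
      "\<omega> \<notin> {\<omega> \<in> space M. exp (\<theta> * x) \<le> (\<Prod>i\<in>I. exp (\<theta> * X' i \<omega>))}"
    show "\<omega> \<in> (\<Union>i\<in>I. {\<omega> \<in> space M. X i \<omega> > t})"
    proof (rule ccontr)
      assume "\<not> ?thesis"
      then have "(\<Sum>i\<in>I. X' i \<omega>) = (\<Sum>i\<in>I. X i \<omega>)" using w by (intro sum.cong) (auto simp: X'_def)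
      then have "exp (\<theta> * x) \<le> exp (\<Sum>i\<in>I. \<theta> * X' i \<omega>)"
        using w par by (simp add: sum_distrib_left[symmetric])
      then show False using w fin by (simp add: exp_sum)
    qed
  qed
  then have "prob {\<omega> \<in> space M. x \<le> (\<Sum>i\<in>I. X i \<omega>)}
      \<le> prob ((\<Union>i\<in>I. {\<omega> \<in> space M. X i \<omega> > t})
          \<union> {\<omega> \<in> space M. exp (\<theta> * x) \<le> (\<Prod>i\<in>I. exp (\<theta> * X' i \<omega>))})"
    using fin by (intro finite_measure_mono sets.Un sets.finite_UN) auto
  also have "\<dots> \<le> prob (\<Union>i\<in>I. {\<omega> \<in> space M. X i \<omega> > t})
      + prob {\<omega> \<in> space M. exp (\<theta> * x) \<le> (\<Prod>i\<in>I. exp (\<theta> * X' i \<omega>))}"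
    using fin by (intro measure_Un_le sets.finite_UN) auto
  also have "\<dots> \<le> (\<Sum>i\<in>I. prob {\<omega> \<in> space M. X i \<omega> > t})
      + expectation (\<lambda>\<omega>. \<Prod>i\<in>I. exp (\<theta> * X' i \<omega>)) / exp (\<theta> * x)"
    using fin P_int
    by (intro add_mono finite_measure_subadditive_finite integral_Markov_inequality_measure[where A = "{}"])
      (auto intro!: prod_nonneg)
  also have "\<dots> \<le> real (card I) * v + exp (real (card I) * ?e) / exp (\<theta> * x)"
    using sum_bounded_above[of I "\<lambda>i. prob {\<omega> \<in> space M. X i \<omega> > t}" v] tail
    by (intro add_mono divide_right_mono P_le) auto
  finally show ?thesis by (simp add: exp_diff[symmetric] algebra_simps)
qed

text \<open>The l1 norm dominates the Euclidean one, so a sum longer than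
  \<open>CARD('d) * x\<close> has a coordinate of modulus at least \<open>x\<close>. The factor
  \<open>2 * CARD('d)\<close> counts the signed coordinates, each of which inherits the moment and
  tail bounds of the norm.\<close>

lemma norm_sum_tail:
  fixes X :: "'i \<Rightarrow> 'a \<Rightarrow> real^'d"
  assumes fin: "finite I" and indep: "indep_vars (\<lambda>_. borel) X I"
    and int: "\<And>i. i \<in> I \<Longrightarrow> integrable M (X i)" and mean: "\<And>i. i \<in> I \<Longrightarrow> expectation (X i) = 0"
    and k_int: "\<And>i. i \<in> I \<Longrightarrow> integrable M (\<lambda>\<omega>. norm (X i \<omega>) powr \<kappa>)"
    and k_le: "\<And>i. i \<in> I \<Longrightarrow> expectation (\<lambda>\<omega>. norm (X i \<omega>) powr \<kappa>) \<le> m"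
    and tail: "\<And>i. i \<in> I \<Longrightarrow> prob {\<omega> \<in> space M. norm (X i \<omega>) > t} \<le> v"
    and par: "0 < t" "0 < \<theta>" "1 \<le> \<kappa>" "\<kappa> \<le> 2"
  shows "prob {\<omega> \<in> space M. norm (\<Sum>i\<in>I. X i \<omega>) > real CARD('d) * x}
    \<le> 2 * real CARD('d) * (real (card I) * v + exp (- \<theta> * x + real (card I) * (\<theta> powr \<kappa> * exp (\<theta> * t) * m)))"
    (is "_ \<le> _ * ?R")
proof -
  have [measurable]: "X i \<in> borel_measurable M" if "i \<in> I" for i using int[OF that] by simp
  have comp: "\<bar>y $ j\<bar> \<le> norm y" for y :: "real^'d" and j by (rule component_le_norm_cart)
  have [measurable]: "(\<lambda>\<omega>. X i \<omega> $ j) \<in> borel_measurable M" if "i \<in> I" for i j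
    using borel_measurable_nth by (rule measurable_compose[rotated]) (use that in measurable)
  have ev: "{\<omega> \<in> space M. x \<le> (\<Sum>i\<in>I. c * (X i \<omega> $ j))} \<in> events" for c j
    by measurable
  have 1: "prob {\<omega> \<in> space M. x \<le> (\<Sum>i\<in>I. c * (X i \<omega> $ j))} \<le> ?R" if c: "c = 1 \<or> c = -1" for c :: real and j
  proof (rule truncated_sum_tail[OF fin])
    have ac: "\<bar>c * (X i \<omega> $ j)\<bar> \<le> norm (X i \<omega>)" for i \<omega> using comp c by (auto simp: abs_mult)
    show "indep_vars (\<lambda>_. borel) (\<lambda>i \<omega>. c * (X i \<omega> $ j)) I"
      by (intro indep_vars_compose2[OF indep]) auto
    fix i assume i: "i \<in> I"
    have cj: "X i \<omega> $ j = X i \<omega> \<bullet> axis j 1" for \<omega> by (simp add: inner_axis)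
    show "integrable M (\<lambda>\<omega>. c * (X i \<omega> $ j))" using int[OF i] by (simp add: cj)
    show "expectation (\<lambda>\<omega>. c * (X i \<omega> $ j)) = 0" using int[OF i] mean[OF i] by (simp add: cj)
    show kc: "integrable M (\<lambda>\<omega>. \<bar>c * (X i \<omega> $ j)\<bar> powr \<kappa>)"
      using i par ac by (intro Bochner_Integration.integrable_bound[OF k_int[OF i]]) (auto intro!: powr_mono2)
    have "expectation (\<lambda>\<omega>. \<bar>c * (X i \<omega> $ j)\<bar> powr \<kappa>) \<le> expectation (\<lambda>\<omega>. norm (X i \<omega>) powr \<kappa>)"
      using par ac by (intro integral_mono kc k_int i powr_mono2) auto
    then show "expectation (\<lambda>\<omega>. \<bar>c * (X i \<omega> $ j)\<bar> powr \<kappa>) \<le> m" using k_le[OF i] by linarith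
    have "prob {\<omega> \<in> space M. t < c * (X i \<omega> $ j)} \<le> prob {\<omega> \<in> space M. norm (X i \<omega>) > t}"
      using ac i by (intro finite_measure_mono) (auto, smt (verit))
    then show "prob {\<omega> \<in> space M. t < c * (X i \<omega> $ j)} \<le> v" using tail[OF i] by linarith
  qed (use par in auto)
  have "{\<omega> \<in> space M. norm (\<Sum>i\<in>I. X i \<omega>) > real CARD('d) * x}
     \<subseteq> (\<Union>(c, j)\<in>{1, -1} \<times> UNIV. {\<omega> \<in> space M. x \<le> (\<Sum>i\<in>I. c * (X i \<omega> $ j))})"
  proof safe
    fix \<omega> assume w: "\<omega> \<in> space M" "norm (\<Sum>i\<in>I. X i \<omega>) > real CARD('d) * x"
    have "\<exists>j. x \<le> \<bar>(\<Sum>i\<in>I. X i \<omega>) $ j\<bar>"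
    proof (rule ccontr)
      assume "\<not> ?thesis"
      then have "(\<Sum>j\<in>UNIV. \<bar>(\<Sum>i\<in>I. X i \<omega>) $ j\<bar>) \<le> (\<Sum>j\<in>(UNIV::'d set). x)"
        by (intro sum_mono) (auto simp: not_le less_imp_le)
      then show False using norm_le_l1_cart[of "\<Sum>i\<in>I. X i \<omega>"] w by simp
    qed
    then obtain j where "x \<le> \<bar>\<Sum>i\<in>I. X i \<omega> $ j\<bar>" by auto
    then have "x \<le> (\<Sum>i\<in>I. 1 * (X i \<omega> $ j)) \<or> x \<le> (\<Sum>i\<in>I. -1 * (X i \<omega> $ j))"
      by (auto simp: sum_negf abs_if split: if_splits)
    then show "\<omega> \<in> (\<Union>(c, j)\<in>{1, -1} \<times> UNIV. {\<omega> \<in> space M. x \<le> (\<Sum>i\<in>I. c * (X i \<omega> $ j))})"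
      using w by auto
  qed
  then have "prob {\<omega> \<in> space M. norm (\<Sum>i\<in>I. X i \<omega>) > real CARD('d) * x}
     \<le> prob (\<Union>(c, j)\<in>{1, -1} \<times> UNIV. {\<omega> \<in> space M. x \<le> (\<Sum>i\<in>I. c * (X i \<omega> $ j))})"
    unfolding case_prod_unfold by (intro finite_measure_mono sets.finite_UN ev) auto
  also have "\<dots> \<le> (\<Sum>(c, j)\<in>{1, -1} \<times> (UNIV :: 'd set). prob {\<omega> \<in> space M. x \<le> (\<Sum>i\<in>I. c * (X i \<omega> $ j))})"
    unfolding case_prod_unfold using ev by (intro finite_measure_subadditive_finite) auto
  also have "\<dots> \<le> (\<Sum>(c, j)\<in>{1, -1 :: real} \<times> (UNIV :: 'd set). ?R)"
    using 1 by (intro sum_mono) auto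
  also have "\<dots> = 2 * real CARD('d) * ?R" by (simp add: card_cartesian_product)
  finally show ?thesis .
qed

lemma norm_tail_powr:
  fixes Z :: "'a \<Rightarrow> 'b :: {real_normed_vector, second_countable_topology}"
  assumes "Z \<in> borel_measurable M" "integrable M (\<lambda>\<omega>. norm (Z \<omega>) powr \<alpha>)" "0 < \<alpha>" "0 < t"
  shows "prob {\<omega> \<in> space M. norm (Z \<omega>) > t} \<le> expectation (\<lambda>\<omega>. norm (Z \<omega>) powr \<alpha>) / t powr \<alpha>"
proof -
  note [measurable] = assms(1)
  have "prob {\<omega> \<in> space M. norm (Z \<omega>) > t} \<le> prob {\<omega> \<in> space M. t powr \<alpha> \<le> norm (Z \<omega>) powr \<alpha>}"
    using assms(3,4) by (intro finite_measure_mono) (auto intro!: powr_mono2)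
  also have "\<dots> \<le> expectation (\<lambda>\<omega>. norm (Z \<omega>) powr \<alpha>) / t powr \<alpha>"
    using assms by (intro integral_Markov_inequality_measure[where A = "{}"]) auto
  finally show ?thesis .
qed

end

text \<open>The choice \<open>\<theta> = K ln b / (c b)\<close>, \<open>K = D + 1\<close>, \<open>t = \<delta> b\<close> makes the bound of
  \<open>truncated_sum_tail\<close> at \<open>x = c b\<close> of smaller order than \<open>b\<close> to the power \<open>-D\<close>.\<close>

lemma truncated_tail_bound_tendsto_0:
  fixes b :: "nat \<Rightarrow> real"
  assumes b: "filterlim b at_top sequentially"
    and nb: "\<And>k. k > \<gamma> \<Longrightarrow> (\<lambda>n. real n * b n powr (- k)) \<longlonglongrightarrow> 0"
    and par: "\<kappa> > \<gamma>" "\<kappa> > 0" "\<alpha> > \<gamma> + D" "c > 0" "D > 0"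
  shows "\<exists>\<delta>>0. (\<lambda>n. b n powr D * (real n * (m' / (\<delta> * b n) powr \<alpha>) +
     exp (- ((D + 1) * ln (b n) / (c * b n)) * (c * b n)
        + real n * (((D + 1) * ln (b n) / (c * b n)) powr \<kappa> * exp (((D + 1) * ln (b n) / (c * b n)) * (\<delta> * b n)) * m))))
     \<longlonglongrightarrow> 0"
proof -
  \<comment> \<open>A third of the gap: one part pays for the factor
    \<open>exp (\<theta> * t)\<close>, one brings the exponent of \<open>b n\<close> strictly beyond
    \<open>\<gamma>\<close> so that \<open>nb\<close> applies, and one absorbs the power of the
    logarithm.\<close>
  define e where "e = (\<kappa> - \<gamma>) / 3"
  \<comment> \<open>Chosen so that \<open>\<theta> * t = e * ln b\<close>, that is,
    \<open>exp (\<theta> * t)\<close> is the small power \<open>b powr e\<close>.\<close>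
  define \<delta> where "\<delta> = c * e / (D + 1)"
  have e: "e > 0" "\<delta> > 0" using par by (auto simp: e_def \<delta>_def)
  define E where "E n = real n * b n powr (- (\<gamma> + e)) * (ln (b n) powr \<kappa> * b n powr (- e)) * (((D + 1) / c) powr \<kappa> * m)" for n
  have "((\<lambda>x::real. ln x powr \<kappa> * x powr (- e)) \<longlongrightarrow> 0) at_top"
    using par e by real_asymp
  from filterlim_compose[OF this b] have "(\<lambda>n. ln (b n) powr \<kappa> * b n powr (- e)) \<longlonglongrightarrow> 0" .
  then have "E \<longlonglongrightarrow> 0 * 0 * (((D + 1) / c) powr \<kappa> * m)"
    unfolding E_def[abs_def] using e by (intro tendsto_mult nb tendsto_const) auto
  then have E0: "E \<longlonglongrightarrow> 0" by simp
  have "((\<lambda>x::real. x powr (-1)) \<longlongrightarrow> 0) at_top" by real_asymp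
  from filterlim_compose[OF this b] have b1: "(\<lambda>n. b n powr (-1)) \<longlonglongrightarrow> 0" .
  \<comment> \<open>The two terms after multiplication by \<open>b n powr D\<close>. The large jumps
    vanish because \<alpha> - D > \<gamma>; in the exponential term \<open>K = D + 1\<close> leaves
    one negative power of \<open>b n\<close>.\<close>
  have "(\<lambda>n. m' / \<delta> powr \<alpha> * (real n * b n powr (- (\<alpha> - D))) + b n powr (-1) * exp (E n))
     \<longlonglongrightarrow> m' / \<delta> powr \<alpha> * 0 + 0 * exp 0"
    using par by (intro tendsto_intros nb b1 E0) auto
  moreover have "eventually (\<lambda>n. m' / \<delta> powr \<alpha> * (real n * b n powr (- (\<alpha> - D))) + b n powr (-1) * exp (E n)
    = b n powr D * (real n * (m' / (\<delta> * b n) powr \<alpha>) +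
     exp (- ((D + 1) * ln (b n) / (c * b n)) * (c * b n)
        + real n * (((D + 1) * ln (b n) / (c * b n)) powr \<kappa> * exp (((D + 1) * ln (b n) / (c * b n)) * (\<delta> * b n)) * m)))) sequentially"
    using filterlim_at_top_dense[THEN iffD1, OF b, rule_format, of 1]
  proof eventually_elim
    case (elim n)
    let ?b = "b n"
    have 1: "- ((D + 1) * ln ?b / (c * ?b)) * (c * ?b) = - (D + 1) * ln ?b"
      using elim par by (simp add: field_simps)
    have 2: "(D + 1) * ln ?b / (c * ?b) * (\<delta> * ?b) = e * ln ?b"
    proof -
      have "(D + 1) * u / (c * v) * (c * e / (D + 1) * v) = e * u" if "v > 0" for u v :: real
        using that par by (simp add: divide_simps)
      then show ?thesis using elim by (simp add: \<delta>_def)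
    qed
    have "((D + 1) * ln ?b / (c * ?b)) powr \<kappa> = ((D + 1) / c) powr \<kappa> * ln ?b powr \<kappa> * ?b powr (- \<kappa>)"
      using elim par by (simp add: powr_mult powr_divide powr_minus divide_simps)
    moreover have "exp (e * ln ?b) = ?b powr e" using elim by (simp add: powr_def)
    moreover have "- \<kappa> + e = - (\<gamma> + e) + - e" by (simp add: e_def field_simps)
    then have "?b powr (- \<kappa>) * ?b powr e = ?b powr (- (\<gamma> + e)) * ?b powr (- e)"
      by (metis powr_add)
    ultimately have 3: "real n * (((D + 1) * ln ?b / (c * ?b)) powr \<kappa> * exp (e * ln ?b) * m) = E n"
      by (simp add: E_def mult_ac)
    have 4: "?b powr D * exp (- (D + 1) * ln ?b + E n) = ?b powr (-1) * exp (E n)"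
      using elim by (simp add: powr_def exp_add[symmetric] algebra_simps)
    have 5: "?b powr D * (real n * (m' / (\<delta> * ?b) powr \<alpha>)) = m' / \<delta> powr \<alpha> * (real n * ?b powr (- (\<alpha> - D)))"
      using elim e by (simp add: powr_mult powr_diff powr_minus field_simps)
    show ?case unfolding 1 2 3 distrib_left 4 5 ..
  qed
  ultimately show ?thesis using e(2)
    by (intro exI[of _ \<delta>] conjI) (simp_all add: tendsto_cong)
qed

section \<open>The branching random walk\<close>

text \<open>The union bound for a countable index set without an enumeration, as is convenient for
  the words of a given length.\<close>

lemma emeasure_UN_le_nn_integral_count_space:
  assumes "countable W" "\<And>w. w \<in> W \<Longrightarrow> A w \<in> sets M"
  shows "emeasure M (\<Union>w\<in>W. A w) \<le> (\<integral>\<^sup>+w. emeasure M (A w) \<partial>count_space W)"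
proof -
  have "emeasure M (\<Union>w\<in>W. A w) = (\<integral>\<^sup>+x. indicator (\<Union>w\<in>W. A w) x \<partial>M)"
    using assms by (intro nn_integral_indicator[symmetric] sets.countable_UN') auto
  also have "\<dots> \<le> (\<integral>\<^sup>+x. (\<integral>\<^sup>+w. indicator (A w) x \<partial>count_space W) \<partial>M)"
  proof (intro nn_integral_mono)
    fix x
    show "indicator (\<Union>w\<in>W. A w) x \<le> (\<integral>\<^sup>+w. indicator (A w) x \<partial>count_space W :: ennreal)"
    proof (cases "x \<in> (\<Union>w\<in>W. A w)")
      case True
      then obtain w where "w \<in> W" "x \<in> A w" by auto
      then show ?thesis using nn_integral_ge_point[of w W "\<lambda>w. indicator (A w) x"] True by simp
    qed simp
  qed
  also have "\<dots> = (\<integral>\<^sup>+w. (\<integral>\<^sup>+x. indicator (A w) x \<partial>M) \<partial>count_space W)"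
    using assms by (intro nn_integral_count_space_nn_integral) auto
  also have "\<dots> = (\<integral>\<^sup>+w. emeasure M (A w) \<partial>count_space W)"
    using assms by (intro nn_integral_cong) auto
  finally show ?thesis .
qed

text \<open>At \<open>s = 1\<close> this is the total mass of the Poisson law, at the extinction
  probability it is Poisson thinning.\<close>

lemma poisson_pgf_sums:
  fixes \<mu> s :: real
  shows "(\<lambda>m. exp (- \<mu>) * \<mu> ^ m / fact m * s ^ m) sums exp (- (1 - s) * \<mu>)"
proof -
  have "(\<lambda>m. exp (- \<mu>) * ((s * \<mu>) ^ m /\<^sub>R fact m)) sums (exp (- \<mu>) * exp (s * \<mu>))"
    by (intro sums_mult exp_converges)
  moreover have "exp (- \<mu>) * exp (s * \<mu>) = exp (- (1 - s) * \<mu>)"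
    by (simp add: exp_add[symmetric] algebra_simps)
  ultimately show ?thesis by (simp add: divide_inverse power_mult_distrib mult_ac)
qed

lemma poisson_mean_sums:
  fixes \<mu> :: real
  shows "(\<lambda>m. real m * (exp (- \<mu>) * \<mu> ^ m / fact m)) sums \<mu>"
proof -
  have "(\<lambda>m. \<mu> * (exp (- \<mu>) * \<mu> ^ m / fact m * 1 ^ m)) sums (\<mu> * exp (- (1 - 1) * \<mu>))"
    by (intro sums_mult poisson_pgf_sums)
  moreover have "\<mu> * (exp (- \<mu>) * \<mu> ^ m / fact m * 1 ^ m)
      = real (Suc m) * (exp (- \<mu>) * \<mu> ^ Suc m / fact (Suc m))" for m
    by (simp add: field_simps del: of_nat_Suc)
  ultimately have "(\<lambda>m. real (Suc m) * (exp (- \<mu>) * \<mu> ^ Suc m / fact (Suc m))) sums (\<mu> * exp (- (1 - 1) * \<mu>))"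
    by (simp only:)
  then have "(\<lambda>m. real (Suc m) * (exp (- \<mu>) * \<mu> ^ Suc m / fact (Suc m))) sums \<mu>"
    by (simp del: of_nat_Suc fact_Suc power_Suc)
  then show ?thesis by (subst (asm) sums_Suc_iff) simp
qed

text \<open>Balls are open, so the weak inequality is exact: a particle of norm below
  \<open>r * b\<close> would lie in some vacant ball whose radius is beyond that norm.\<close>

lemma radius_ge_iff:
  assumes "b > 0" "r > 0"
  shows "brw_radius xi Y Xd n \<omega> / ereal b \<ge> ereal r \<longleftrightarrow>
    (\<forall>i w. length w = n \<longrightarrow> brw_alive xi i w \<omega> \<longrightarrow> brw_position Y Xd i w \<omega> \<notin> ball 0 (r * b))"
    (is "_ \<longleftrightarrow> ?N (r * b)")
proof -
  have cnt: "brw_count xi Y Xd n \<omega> (ball 0 u) = 0 \<longleftrightarrow> ?N u" for u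
  proof -
    have "brw_count xi Y Xd n \<omega> (ball 0 u) = 0 \<longleftrightarrow>
      {(i, w). length w = n \<and> brw_alive xi i w \<omega> \<and> brw_position Y Xd i w \<omega> \<in> ball 0 u} = {}"
    proof -
      have "(if finite S then enat (card S) else \<infinity>) = 0 \<longleftrightarrow> S = {}" for S :: "(nat \<times> nat list) set"
        by (auto simp: zero_enat_def)
      then show ?thesis unfolding brw_count_def Let_def .
    qed
    then show ?thesis by auto
  qed
  have "ereal r \<le> brw_radius xi Y Xd n \<omega> / ereal b \<longleftrightarrow> ereal (r * b) \<le> brw_radius xi Y Xd n \<omega>"
    using assms by (subst ereal_le_divide_pos) (auto simp: mult.commute)
  also have "\<dots> \<longleftrightarrow> ?N (r * b)"
  proof
    assume "?N (r * b)"
    then have "ereal (r * b) \<le> (SUP u \<in> {u::real. u > 0 \<and> brw_count xi Y Xd n \<omega> (ball 0 u) = 0}. ereal u)"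
      using assms by (intro SUP_upper) (simp add: cnt)
    then show "ereal (r * b) \<le> brw_radius xi Y Xd n \<omega>"
      unfolding brw_radius_def by (rule le_supI2)
  next
    assume le: "ereal (r * b) \<le> brw_radius xi Y Xd n \<omega>"
    show "?N (r * b)"
    proof (intro allI impI notI)
      fix i w assume w: "length w = n" "brw_alive xi i w \<omega>" "brw_position Y Xd i w \<omega> \<in> ball 0 (r * b)"
      then have "ereal (norm (brw_position Y Xd i w \<omega>)) < ereal (r * b)" by simp
      then have "ereal (norm (brw_position Y Xd i w \<omega>)) < brw_radius xi Y Xd n \<omega>"
        using le by (rule less_le_trans)
      \<comment> \<open>The default value 0 in the radius cannot exceed a norm, so the supremum
        itself does.\<close>
      then have "ereal (norm (brw_position Y Xd i w \<omega>))
          < (SUP u \<in> {u::real. u > 0 \<and> brw_count xi Y Xd n \<omega> (ball 0 u) = 0}. ereal u)"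
        unfolding brw_radius_def sup_max less_max_iff_disj by auto
      then obtain u where "norm (brw_position Y Xd i w \<omega>) < u" "?N u"
        by (auto simp: less_SUP_iff cnt)
      then show False using w by auto
    qed
  qed
  finally show ?thesis .
qed

locale branching_random_walk = prob_space M for M :: "'a measure" +
  fixes p :: "nat \<Rightarrow> real"
    and Y :: "nat \<Rightarrow> 'a \<Rightarrow> real^'d"
    and xi :: "nat \<times> nat list \<Rightarrow> 'a \<Rightarrow> nat"
    and Xd :: "nat \<times> nat list \<Rightarrow> 'a \<Rightarrow> real^'d"
  assumes p_nonneg: "\<And>k. p k \<ge> 0"
    and mean: "(\<lambda>k. real k * p k) sums 1"
    and poisson: "poisson_lebesgue_points M Y"
    and offspring: "\<And>x k. measure M {\<omega> \<in> space M. xi x \<omega> = k} = p k"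
    and disp_meas: "\<And>x. Xd x \<in> borel_measurable M"
    and disp_ident: "\<And>x. distr M borel (Xd x) = distr M borel (Xd (0, []))"
    and indep: "brw_independent M Y xi Xd"
begin

section \<open>Independence of events that depend on disjoint sources of randomness\<close>

definition gen :: "unit + (nat \<times> nat list) + (nat \<times> nat list) \<Rightarrow> 'a set set" where
  "gen k = (case k of
          Inl (_::unit) \<Rightarrow> {(\<lambda>\<omega>. \<lambda>i. Y i \<omega>) -` A \<inter> space M | A. A \<in> sets (PiM (UNIV::nat set) (\<lambda>_. borel))}
        | Inr (Inl x) \<Rightarrow> {xi x -` A \<inter> space M | A. True}
        | Inr (Inr x) \<Rightarrow> {Xd x -` A \<inter> space M | A. A \<in> sets borel})"

text \<open>The sigma-algebra of the events determined by the sources in \<open>J\<close>, packaged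
  as a measure so that measurability of random variables with respect to it can be stated and proved
  in the usual way.\<close>

definition info :: "(unit + (nat \<times> nat list) + (nat \<times> nat list)) set \<Rightarrow> 'a measure" where
  "info J = sigma (space M) (\<Union>k\<in>J. gen k)"

lemma indep_gen: "indep_sets gen UNIV"
  using indep unfolding brw_independent_def gen_def[abs_def] .

lemma gen_events: "gen k \<subseteq> events"
  using indep_gen by (auto simp: indep_sets_def)

lemma Int_stable_gen: "Int_stable (gen k)"
proof -
  have vim: "Int_stable {f -` A \<inter> space M | A. A \<in> \<A>}" if "\<And>A B. A \<in> \<A> \<Longrightarrow> B \<in> \<A> \<Longrightarrow> A \<inter> B \<in> \<A>"
    for f :: "'a \<Rightarrow> 'c" and \<A>
    using that by (auto simp: Int_stable_def) (metis Int_assoc inf_commute inf_left_idem vimage_Int)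
  show ?thesis
    using vim[of "sets (PiM (UNIV::nat set) (\<lambda>_. borel))"] vim[of UNIV] vim[of "sets borel"]
    by (auto simp: gen_def split: sum.splits)
qed

lemma sets_info: "sets (info J) = sigma_sets (space M) (\<Union>k\<in>J. gen k)"
  unfolding info_def using gen_events sets.space_closed by (intro sets_measure_of) blast

lemma space_info [simp]: "space (info J) = space M"
  unfolding info_def by (simp add: space_measure_of_conv)

lemma info_events: "A \<in> sets (info J) \<Longrightarrow> A \<in> events"
  unfolding sets_info using gen_events sets.sigma_sets_subset[of "\<Union>k\<in>J. gen k" M] by blast

lemma sets_info_mono: "J \<subseteq> J' \<Longrightarrow> A \<in> sets (info J) \<Longrightarrow> A \<in> sets (info J')"
  unfolding sets_info by (rule subsetD[OF sigma_sets_mono']) auto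

text \<open>The generators are stable under intersection, so independence passes from single sources
  to the sigma-algebras of disjoint groups of sources.\<close>

lemma indep_info:
  assumes fin: "finite K" and disj: "disjoint_family_on I K"
    and A: "\<And>j. j \<in> K \<Longrightarrow> {\<omega> \<in> space M. P j \<omega>} \<in> sets (info (I j))"
  shows "prob {\<omega> \<in> space M. \<forall>j\<in>K. P j \<omega>} = (\<Prod>j\<in>K. prob {\<omega> \<in> space M. P j \<omega>})"
proof (cases "K = {}")
  case True
  then show ?thesis by (simp add: prob_space)
next
  case False
  have "indep_sets (\<lambda>j. sigma_sets (space M) (\<Union>k\<in>I j. gen k)) K"
    by (intro indep_sets_collect_sigma disj Int_stable_gen indep_sets_mono_index[OF _ indep_gen]) auto
  then have "prob (\<Inter>j\<in>K. {\<omega> \<in> space M. P j \<omega>}) = (\<Prod>j\<in>K. prob {\<omega> \<in> space M. P j \<omega>})"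
    using A False fin by (intro indep_setsD) (auto simp: sets_info)
  also have "(\<Inter>j\<in>K. {\<omega> \<in> space M. P j \<omega>}) = {\<omega> \<in> space M. \<forall>j\<in>K. P j \<omega>}"
    using False by auto
  finally show ?thesis .
qed

lemma indep_info2:
  assumes disj: "J \<inter> J' = {}"
    and A: "{\<omega> \<in> space M. P \<omega>} \<in> sets (info J)" "{\<omega> \<in> space M. Q \<omega>} \<in> sets (info J')"
  shows "prob {\<omega> \<in> space M. P \<omega> \<and> Q \<omega>} = prob {\<omega> \<in> space M. P \<omega>} * prob {\<omega> \<in> space M. Q \<omega>}"
proof -
  have "prob {\<omega> \<in> space M. \<forall>j\<in>UNIV. (case_bool P Q) j \<omega>}
      = (\<Prod>j\<in>UNIV. prob {\<omega> \<in> space M. (case_bool P Q) j \<omega>})"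
    using assms by (intro indep_info[where I = "case_bool J J'"])
      (auto simp: disjoint_family_on_def split: bool.splits)
  moreover have "{\<omega> \<in> space M. \<forall>j\<in>UNIV. (case_bool P Q) j \<omega>} = {\<omega> \<in> space M. P \<omega> \<and> Q \<omega>}"
    by (auto split: bool.splits)
  ultimately show ?thesis by (simp add: UNIV_bool mult.commute)
qed

lemma xi_measurable_info: "Inr (Inl x) \<in> J \<Longrightarrow> xi x \<in> info J \<rightarrow>\<^sub>M count_space UNIV"
proof (rule measurableI)
  fix A
  have "xi x -` A \<inter> space M \<in> gen (Inr (Inl x))" by (auto simp: gen_def)
  then show "Inr (Inl x) \<in> J \<Longrightarrow> xi x -` A \<inter> space (info J) \<in> sets (info J)"
    by (auto simp: sets_info intro!: sigma_sets.Basic)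
qed simp

lemma Xd_measurable_info: "Inr (Inr x) \<in> J \<Longrightarrow> Xd x \<in> borel_measurable (info J)"
proof (rule measurableI)
  fix A :: "(real^'d) set" assume "A \<in> sets borel"
  then have "Xd x -` A \<inter> space M \<in> gen (Inr (Inr x))" by (auto simp: gen_def)
  then show "Inr (Inr x) \<in> J \<Longrightarrow> Xd x -` A \<inter> space (info J) \<in> sets (info J)"
    by (auto simp: sets_info intro!: sigma_sets.Basic)
qed simp

lemma Y_measurable_info: assumes "Inl () \<in> J" shows "Y i \<in> borel_measurable (info J)"
proof (rule measurableI)
  fix A :: "(real^'d) set" assume A: "A \<in> sets borel"
  have "(\<lambda>f. f i) -` A \<inter> space (PiM UNIV (\<lambda>_. borel)) \<in> sets (PiM (UNIV::nat set) (\<lambda>_. borel))"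
    using A by (intro measurable_sets[OF measurable_component_singleton]) auto
  then have "(\<lambda>f. f i) -` A \<in> sets (PiM (UNIV::nat set) (\<lambda>_. borel))" by (simp add: space_PiM)
  then have "(\<lambda>\<omega> i. Y i \<omega>) -` ((\<lambda>f. f i) -` A) \<inter> space M \<in> gen (Inl ())" by (auto simp: gen_def)
  moreover have "(\<lambda>\<omega> i. Y i \<omega>) -` ((\<lambda>f. f i) -` A) \<inter> space M = Y i -` A \<inter> space M" by auto
  ultimately show "Y i -` A \<inter> space (info J) \<in> sets (info J)"
    using assms by (auto simp: sets_info intro!: sigma_sets.Basic bexI[of _ "Inl ()"])
qed simp

lemma xi_measurable [measurable]: "xi x \<in> M \<rightarrow>\<^sub>M count_space UNIV"
  using measurable_sets[OF xi_measurable_info[of x UNIV]] by (intro measurableI) (auto intro: info_events)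

lemma Y_measurable [measurable]: "Y i \<in> borel_measurable M"
  using poisson by (auto simp: poisson_lebesgue_points_def)

lemmas [measurable] = disp_meas

section \<open>Extinction probabilities and mean population\<close>

text \<open>Recursion through the children of \<open>v\<close>, where \<open>brw_alive\<close>
  follows a whole line of descent: extinction thereby splits into events about disjoint
  subtrees.\<close>

primrec dead :: "nat \<Rightarrow> nat \<Rightarrow> nat list \<Rightarrow> 'a \<Rightarrow> bool" where
  "dead 0 i v \<omega> = False"
| "dead (Suc n) i v \<omega> = (\<forall>k<xi (i, v) \<omega>. dead n i (v @ [k]) \<omega>)"

lemma dead_iff:
  "dead n i v \<omega> \<longleftrightarrow> \<not> (\<exists>w. length w = n \<and> (\<forall>j<length w. w ! j < xi (i, v @ take j w) \<omega>))"
proof (induction n arbitrary: v)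
  case (Suc n)
  have "(\<exists>w. length w = Suc n \<and> (\<forall>j<length w. w ! j < xi (i, v @ take j w) \<omega>))
     \<longleftrightarrow> (\<exists>k w. length w = n \<and> k < xi (i, v) \<omega> \<and> (\<forall>j<length w. w ! j < xi (i, (v @ [k]) @ take j w) \<omega>))"
  proof -
    have "(\<exists>w. length w = Suc n \<and> Q w) \<longleftrightarrow> (\<exists>k w. length w = n \<and> Q (k # w))" for Q :: "nat list \<Rightarrow> bool"
      by (metis length_Suc_conv)
    then show ?thesis by (simp add: All_less_Suc2)
  qed
  then show ?case by (auto simp: Suc)
qed simp

lemma dead_root_iff: "dead n i [] \<omega> \<longleftrightarrow> \<not> (\<exists>w. length w = n \<and> brw_alive xi i w \<omega>)"
  by (simp add: dead_iff brw_alive_def)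

text \<open>Extinction below \<open>v\<close> reads only offspring numbers in the subtree of
  \<open>v\<close>. Subtrees of different siblings, or of different roots, are disjoint, whence the
  independence used later.\<close>

lemma dead_info: "{\<omega> \<in> space M. dead n i v \<omega>} \<in> sets (info {Inr (Inl (i, v @ u)) | u. True})"
proof (induction n arbitrary: v)
  case (Suc n)
  let ?J = "{Inr (Inl (i, v @ u)) | u. True} :: (unit + (nat \<times> nat list) + (nat \<times> nat list)) set"
  have "{\<omega> \<in> space M. dead n i (v @ [k]) \<omega>} \<in> sets (info ?J)" for k
    by (rule sets_info_mono[OF _ Suc]) auto
  then have [measurable]: "Measurable.pred (info ?J) (dead n i (v @ [k]))" for k
    by (simp add: pred_def)
  have [measurable]: "xi (i, v) \<in> info ?J \<rightarrow>\<^sub>M count_space UNIV"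
    by (rule xi_measurable_info) (auto intro: exI[of _ "[]"])
  have "Measurable.pred (info ?J) (\<lambda>\<omega>. \<forall>k. k < xi (i, v) \<omega> \<longrightarrow> dead n i (v @ [k]) \<omega>)" by measurable
  then show ?case by (simp add: pred_def)
qed simp

lemma dead_event [measurable]: "Measurable.pred M (dead n i v)"
  using info_events[OF dead_info] by (simp add: pred_def)

text \<open>The branching property: given \<open>m\<close> children, their \<open>m\<close> subtrees
  die out independently of each other and of the number \<open>m\<close>, so one generation applies
  the generating function once.\<close>

lemma prob_dead: "prob {\<omega> \<in> space M. dead n i v \<omega>} = ((\<lambda>s. \<Sum>k. p k * s ^ k) ^^ n) 0"
proof (induction n arbitrary: v)
  case (Suc n)
  let ?d = "((\<lambda>s. \<Sum>k. p k * s ^ k) ^^ n) 0"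
  let ?A = "\<lambda>m. {\<omega> \<in> space M. xi (i, v) \<omega> = m \<and> (\<forall>k\<in>{..<m}. dead n i (v @ [k]) \<omega>)}"
  let ?I = "\<lambda>k. {Inr (Inl (i, (v @ [k]) @ u)) | u. True} :: (unit + (nat \<times> nat list) + (nat \<times> nat list)) set"
  have A: "prob (?A m) = p m * ?d ^ m" for m
  proof -
    have kids: "prob {\<omega> \<in> space M. \<forall>k\<in>{..<m}. dead n i (v @ [k]) \<omega>}
        = (\<Prod>k<m. prob {\<omega> \<in> space M. dead n i (v @ [k]) \<omega>})"
      by (rule indep_info[where I = ?I]) (use dead_info in \<open>auto simp: disjoint_family_on_def simp del: append_assoc\<close>)
    have sub: "{\<omega> \<in> space M. \<forall>k\<in>{..<m}. dead n i (v @ [k]) \<omega>} \<in> sets (info (\<Union>k. ?I k))"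
    proof -
      have "{\<omega> \<in> space M. dead n i (v @ [k]) \<omega>} \<in> sets (info (\<Union>k. ?I k))" for k
        by (rule sets_info_mono[OF _ dead_info]) auto
      then have [measurable]: "Measurable.pred (info (\<Union>k. ?I k)) (dead n i (v @ [k]))" for k
        by (simp add: pred_def)
      have "Measurable.pred (info (\<Union>k. ?I k)) (\<lambda>\<omega>. \<forall>k\<in>{..<m}. dead n i (v @ [k]) \<omega>)" by measurable
      then show ?thesis by (simp add: pred_def)
    qed
    have xi: "{\<omega> \<in> space M. xi (i, v) \<omega> = m} \<in> sets (info {Inr (Inl (i, v))})"
    proof -
      have [measurable]: "xi (i, v) \<in> info {Inr (Inl (i, v))} \<rightarrow>\<^sub>M count_space UNIV"
        by (rule xi_measurable_info) auto
      have "Measurable.pred (info {Inr (Inl (i, v))}) (\<lambda>\<omega>. xi (i, v) \<omega> = m)" by measurable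
      then show ?thesis by (simp add: pred_def)
    qed
    have "prob (?A m) = prob {\<omega> \<in> space M. xi (i, v) \<omega> = m}
        * prob {\<omega> \<in> space M. \<forall>k\<in>{..<m}. dead n i (v @ [k]) \<omega>}"
      by (rule indep_info2[OF _ xi sub]) auto
    then show ?thesis by (simp add: kids offspring Suc)
  qed
  have "(\<lambda>m. prob (?A m)) sums prob (\<Union>m. ?A m)"
    by (intro finite_measure_UNION) (auto simp: disjoint_family_on_def)
  moreover have "(\<Union>m. ?A m) = {\<omega> \<in> space M. dead (Suc n) i v \<omega>}" by auto
  ultimately show ?case by (simp add: A sums_iff)
qed simp

lemma survival_eq: "brw_survival M xi n = 1 - ((\<lambda>s. \<Sum>k. p k * s ^ k) ^^ n) 0"
proof -
  have "brw_survival M xi n = prob (space M - {\<omega> \<in> space M. dead n 0 [] \<omega>})"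
    unfolding brw_survival_def dead_root_iff by (intro arg_cong[where f = prob]) auto
  then show ?thesis by (simp add: prob_compl prob_dead)
qed

text \<open>Separates survival of a line, an event about offspring numbers, from starting points and
  displacements.\<close>

lemma alive_info: "{\<omega> \<in> space M. brw_alive xi i w \<omega>} \<in> sets (info {Inr (Inl x) | x. True})"
proof -
  have [measurable]: "xi x \<in> info {Inr (Inl x) | x. True} \<rightarrow>\<^sub>M count_space UNIV" for x
    by (rule xi_measurable_info) auto
  have "Measurable.pred (info {Inr (Inl x) | x. True}) (\<lambda>\<omega>. \<forall>j. j < length w \<longrightarrow> w ! j < xi (i, take j w) \<omega>)"
    by measurable
  then show ?thesis unfolding pred_def brw_alive_def space_info .
qed

lemma alive_event [measurable]: "Measurable.pred M (brw_alive xi i w)"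
  using info_events[OF alive_info] by (simp add: pred_def)

text \<open>The tail formula for the mean: the child with label \<open>k\<close> exists exactly when
  \<open>k < xi x \<omega>\<close>.\<close>

lemma suminf_prob_offspring_gt: "(\<Sum>k. emeasure M {\<omega> \<in> space M. k < xi x \<omega>}) = 1"
proof -
  have "(\<Sum>k. emeasure M {\<omega> \<in> space M. k < xi x \<omega>}) = (\<integral>\<^sup>+\<omega>. of_nat (xi x \<omega>) \<partial>M)"
    by (rule nn_integral_nat_function[symmetric]) simp
  also have "\<dots> = (\<integral>\<^sup>+\<omega>. (\<Sum>k. of_nat k * indicator {\<omega> \<in> space M. xi x \<omega> = k} \<omega>) \<partial>M)"
  proof (intro nn_integral_cong)
    fix \<omega> assume "\<omega> \<in> space M"
    then show "of_nat (xi x \<omega>) = (\<Sum>k. of_nat k * indicator {\<omega> \<in> space M. xi x \<omega> = k} \<omega> :: ennreal)"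
      by (subst suminf_finite[of "{xi x \<omega>}"]) auto
  qed
  also have "\<dots> = (\<Sum>k. of_nat k * emeasure M {\<omega> \<in> space M. xi x \<omega> = k})"
    by (subst nn_integral_suminf) (auto simp: nn_integral_cmult_indicator)
  also have "\<dots> = (\<Sum>k. ennreal (real k * p k))"
    by (simp add: emeasure_eq_measure offspring ennreal_mult' ennreal_of_nat_eq_real_of_nat)
  also have "\<dots> = ennreal 1" using p_nonneg mean by (intro suminf_ennreal_eq) auto
  finally show ?thesis by simp
qed

text \<open>Appending a letter \<open>k\<close> to a word multiplies its survival probability by
  that of \<open>k < xi (i, w) \<omega>\<close>, and these factors sum to the mean 1.\<close>

lemma expected_population:
  "(\<integral>\<^sup>+w. emeasure M {\<omega> \<in> space M. brw_alive xi i w \<omega>} \<partial>count_space {w. length w = n}) = 1"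
proof (induction n)
  case 0
  have "{w :: nat list. length w = 0} = {[]}" by auto
  then show ?case by (simp add: nn_integral_count_space_finite brw_alive_def emeasure_space_1)
next
  case (Suc n)
  let ?a = "\<lambda>w. emeasure M {\<omega> \<in> space M. brw_alive xi i w \<omega>}"
  have step: "?a (w @ [k]) = ?a w * emeasure M {\<omega> \<in> space M. k < xi (i, w) \<omega>}" for w k
  proof -
    \<comment> \<open>Survival of \<open>w\<close> reads the offspring numbers of its proper
      prefixes, all shorter than \<open>w\<close>, hence not the offspring number of
      \<open>w\<close> itself.\<close>
    let ?J = "{Inr (Inl (i, u)) | u. length u < length w} :: (unit + (nat \<times> nat list) + (nat \<times> nat list)) set"
    have "prob {\<omega> \<in> space M. brw_alive xi i w \<omega> \<and> k < xi (i, w) \<omega>}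
       = prob {\<omega> \<in> space M. brw_alive xi i w \<omega>} * prob {\<omega> \<in> space M. k < xi (i, w) \<omega>}"
    proof (rule indep_info2[where J = ?J and J' = "{Inr (Inl (i, w))}"])
      have [measurable]: "xi (i, take j w) \<in> info ?J \<rightarrow>\<^sub>M count_space UNIV" if "j < length w" for j
        using that by (intro xi_measurable_info) auto
      have "Measurable.pred (info ?J) (\<lambda>\<omega>. \<forall>j\<in>{..<length w}. w ! j < xi (i, take j w) \<omega>)" by measurable
      then show "{\<omega> \<in> space M. brw_alive xi i w \<omega>} \<in> sets (info ?J)"
        unfolding pred_def brw_alive_def space_info Ball_def lessThan_iff .
      have [measurable]: "xi (i, w) \<in> info {Inr (Inl (i, w))} \<rightarrow>\<^sub>M count_space UNIV"
        by (rule xi_measurable_info) auto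
      have "Measurable.pred (info {Inr (Inl (i, w))}) (\<lambda>\<omega>. k < xi (i, w) \<omega>)" by measurable
      then show "{\<omega> \<in> space M. k < xi (i, w) \<omega>} \<in> sets (info {Inr (Inl (i, w))})"
        by (simp add: pred_def)
      show "?J \<inter> {Inr (Inl (i, w))} = {}" by auto
    qed
    moreover have "{\<omega> \<in> space M. brw_alive xi i (w @ [k]) \<omega>}
        = {\<omega> \<in> space M. brw_alive xi i w \<omega> \<and> k < xi (i, w) \<omega>}"
      by (auto simp: brw_alive_def nth_append less_Suc_eq)
    ultimately show ?thesis by (simp add: emeasure_eq_measure ennreal_mult')
  qed
  have bij: "bij_betw (\<lambda>(w, k). w @ [k]) ({w. length w = n} \<times> UNIV) {w :: nat list. length w = Suc n}"
    by (rule bij_betwI[where g = "\<lambda>w. (butlast w, last w)"]) (auto, metis append_butlast_last_id list.size(3) nat.simps(3))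
  have cnt: "countable {w :: nat list. length w = n}" by auto
  interpret L: sigma_finite_measure "count_space (UNIV :: nat set)"
    by (rule sigma_finite_measure_count_space)
  have "(\<integral>\<^sup>+w. ?a w \<partial>count_space {w. length w = Suc n})
      = (\<integral>\<^sup>+wk. ?a (fst wk @ [snd wk]) \<partial>count_space ({w. length w = n} \<times> UNIV))"
    using nn_integral_bij_count_space[OF bij, of ?a] by (simp add: case_prod_unfold)
  also have "\<dots> = (\<integral>\<^sup>+wk. ?a (fst wk @ [snd wk]) \<partial>(count_space {w. length w = n} \<Otimes>\<^sub>M count_space UNIV))"
    using pair_measure_countable[OF cnt, of "UNIV :: nat set"] by simp
  also have "\<dots> = (\<integral>\<^sup>+w. \<integral>\<^sup>+k. ?a (w @ [k]) \<partial>count_space UNIV \<partial>count_space {w. length w = n})"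
    using L.nn_integral_fst[of "\<lambda>wk. ?a (fst wk @ [snd wk])" "count_space {w. length w = n}"]
      pair_measure_countable[OF cnt, of "UNIV :: nat set"] by simp
  also have "\<dots> = (\<integral>\<^sup>+w. ?a w \<partial>count_space {w. length w = n})"
    by (intro nn_integral_cong)
      (simp add: step nn_integral_cmult nn_integral_count_space_nat suminf_prob_offspring_gt)
  finally show ?case by (simp add: Suc)
qed

section \<open>Displacement along a line of descent\<close>

definition walk :: "nat \<Rightarrow> nat list \<Rightarrow> 'a \<Rightarrow> real^'d" where
  "walk i w \<omega> = (\<Sum>j\<in>{1..length w}. Xd (i, take j w) \<omega>)"

text \<open>Built from the product of the one-step law, so that it depends on the length only and
  can be taken out of sums over roots and words.\<close>

definition walk_law :: "nat \<Rightarrow> (real^'d) measure" where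
  "walk_law n = distr (PiM {1..n} (\<lambda>_. distr M borel (Xd (0, [])))) borel (\<lambda>x. \<Sum>j\<in>{1..n}. x j)"

lemma position_eq: "brw_position Y Xd i w \<omega> = Y i \<omega> + walk i w \<omega>"
  by (simp add: brw_position_def walk_def)

lemma walk_measurable [measurable]: "walk i w \<in> borel_measurable M"
  unfolding walk_def[abs_def] by measurable

text \<open>Prefixes of different lengths are different particles, so their displacements are
  distinct sources.\<close>

lemma indep_steps: "indep_vars (\<lambda>_. borel) (\<lambda>j. Xd (i, take j w)) {1..length w}"
  unfolding indep_vars_def2
proof (intro conjI ballI indep_setsI)
  fix A J assume J: "J \<noteq> {}" "J \<subseteq> {1..length w}" "finite J"
    and A: "\<forall>j\<in>J. A j \<in> {Xd (i, take j w) -` B \<inter> space M | B. B \<in> sets borel}"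
  have sub: "A j \<subseteq> space M" if "j \<in> J" for j using A that by auto
  have "prob {\<omega> \<in> space M. \<forall>j\<in>J. \<omega> \<in> A j} = (\<Prod>j\<in>J. prob {\<omega> \<in> space M. \<omega> \<in> A j})"
  proof (rule indep_info[where I = "\<lambda>j. {Inr (Inr (i, take j w))}"])
    have "take j w \<noteq> take k w" if "j \<in> J" "k \<in> J" "j \<noteq> k" for j k
    proof
      assume "take j w = take k w"
      then have "length (take j w) = length (take k w)" by (rule arg_cong)
      moreover have "j \<le> length w" "k \<le> length w" using that J by auto
      ultimately show False using that by simp
    qed
    then show "disjoint_family_on (\<lambda>j. {Inr (Inr (i, take j w)) :: unit + (nat \<times> nat list) + (nat \<times> nat list)}) J"
      by (simp add: disjoint_family_on_def)
    fix j assume j: "j \<in> J"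
    then obtain B where B: "A j = Xd (i, take j w) -` B \<inter> space M" "B \<in> sets borel" using A by blast
    have "A j \<in> sets (info {Inr (Inr (i, take j w))})"
      using measurable_sets[OF Xd_measurable_info[of "(i, take j w)" "{Inr (Inr (i, take j w))}"] B(2)] B(1) by simp
    also have "A j = {\<omega> \<in> space M. \<omega> \<in> A j}" using sub[OF j] by auto
    finally show "{\<omega> \<in> space M. \<omega> \<in> A j} \<in> sets (info {Inr (Inr (i, take j w))})" .
  qed fact
  moreover have "{\<omega> \<in> space M. \<forall>j\<in>J. \<omega> \<in> A j} = (\<Inter>j\<in>J. A j)" using sub J(1) by auto
  moreover have "{\<omega> \<in> space M. \<omega> \<in> A j} = A j" if "j \<in> J" for j using sub[OF that] by auto
  ultimately show "prob (\<Inter>j\<in>J. A j) = (\<Prod>j\<in>J. prob (A j))" by simp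
qed auto

text \<open>By independence the joint law of the steps is the product measure. This characterisation
  takes a nonempty index set, hence \<open>n > 0\<close>.\<close>

lemma distr_walk:
  assumes "length w = n" "n > 0" shows "distr M borel (walk i w) = walk_law n"
proof -
  have ne: "{1..n} \<noteq> {}" using assms by auto
  have "distr M (PiM {1..n} (\<lambda>_. borel)) (\<lambda>\<omega>. \<lambda>j\<in>{1..n}. Xd (i, take j w) \<omega>)
      = PiM {1..n} (\<lambda>j. distr M borel (Xd (i, take j w)))"
    using indep_steps[of i w] assms(1) by (subst (asm) indep_vars_iff_distr_eq_PiM'[OF ne[folded assms(1)]]) auto
  then have P: "PiM {1..n} (\<lambda>_. distr M borel (Xd (0, [])))
      = distr M (PiM {1..n} (\<lambda>_. borel)) (\<lambda>\<omega>. \<lambda>j\<in>{1..n}. Xd (i, take j w) \<omega>)"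
    using arg_cong[where f = "PiM {1..n}", OF ext[OF disp_ident]] by metis
  have "walk_law n = distr M borel ((\<lambda>x. \<Sum>j\<in>{1..n}. x j) \<circ> (\<lambda>\<omega>. \<lambda>j\<in>{1..n}. Xd (i, take j w) \<omega>))"
    unfolding walk_law_def P by (rule distr_distr) auto
  also have "(\<lambda>x. \<Sum>j\<in>{1..n}. x j) \<circ> (\<lambda>\<omega>. \<lambda>j\<in>{1..n}. Xd (i, take j w) \<omega>) = walk i w"
    by (auto simp: fun_eq_iff walk_def assms(1))
  finally show ?thesis ..
qed

lemma measurable_info_imp_measurable:
  assumes "W \<in> info I \<rightarrow>\<^sub>M L" shows "W \<in> M \<rightarrow>\<^sub>M L"
proof (rule measurableI)
  show "W \<omega> \<in> space L" if "\<omega> \<in> space M" for \<omega> using measurable_space[OF assms] that by simp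
  show "W -` A \<inter> space M \<in> events" if "A \<in> sets L" for A
    using info_events[OF measurable_sets[OF assms that]] by simp
qed

lemma sigma_sets_vimage_info:
  assumes "W \<in> info I \<rightarrow>\<^sub>M L"
  shows "sigma_sets (space M) {W -` A \<inter> space M | A. A \<in> sets L} \<subseteq> sets (info I)"
proof -
  have "{W -` A \<inter> space M | A. A \<in> sets L} \<subseteq> sets (info I)"
    using measurable_sets[OF assms] by auto
  then show ?thesis using sets.sigma_sets_subset[of _ "info I"] by simp
qed

lemma indep_var_info:
  assumes "J \<inter> J' = {}" "U \<in> info J \<rightarrow>\<^sub>M N" "V \<in> info J' \<rightarrow>\<^sub>M N'"
  shows "indep_var N U N' V"
proof -
  note sub = sigma_sets_vimage_info[OF assms(2)] sigma_sets_vimage_info[OF assms(3)]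
  show ?thesis unfolding indep_var_eq
  proof (intro conjI indep_setI)
    show "sigma_sets (space M) {U -` A \<inter> space M | A. A \<in> sets N} \<subseteq> events"
      "sigma_sets (space M) {V -` A \<inter> space M | A. A \<in> sets N'} \<subseteq> events"
      using sub info_events by blast+
    show "random_variable N U" "random_variable N' V" using measurable_info_imp_measurable assms(2,3) by blast+
    fix a b assume "a \<in> sigma_sets (space M) {U -` A \<inter> space M | A. A \<in> sets N}"
      "b \<in> sigma_sets (space M) {V -` A \<inter> space M | A. A \<in> sets N'}"
    then have ab: "a \<in> sets (info J)" "b \<in> sets (info J')" using sub by blast+
    then have "a \<subseteq> space M" "b \<subseteq> space M" using sets.sets_into_space by fastforce+
    then have "a = {\<omega> \<in> space M. \<omega> \<in> a}" "b = {\<omega> \<in> space M. \<omega> \<in> b}"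
      "a \<inter> b = {\<omega> \<in> space M. \<omega> \<in> a \<and> \<omega> \<in> b}" by auto
    then show "prob (a \<inter> b) = prob a * prob b"
      using indep_info2[OF assms(1), of "\<lambda>\<omega>. \<omega> \<in> a" "\<lambda>\<omega>. \<omega> \<in> b"] ab by metis
  qed
qed

text \<open>Fubini's theorem for the independent pair of start and displacement. The start is left
  inside, because its law is known only after summation over \<open>i\<close>.\<close>

lemma emeasure_start_walk:
  assumes n: "length w = n" "n > 0" and E: "E \<in> sets (borel \<Otimes>\<^sub>M borel)"
  shows "emeasure M {\<omega> \<in> space M. (Y i \<omega>, walk i w \<omega>) \<in> E}
      = (\<integral>\<^sup>+s. emeasure M {\<omega> \<in> space M. (Y i \<omega>, s) \<in> E} \<partial>walk_law n)"
proof -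
  have "indep_var borel (Y i) borel (walk i w)"
  proof (rule indep_var_info[where J = "{Inl ()}" and J' = "{Inr (Inr x) | x. True}"])
    show "Y i \<in> borel_measurable (info {Inl ()})" by (rule Y_measurable_info) simp
    have [measurable]: "Xd x \<in> borel_measurable (info {Inr (Inr x) | x. True})" for x
      by (rule Xd_measurable_info) auto
    show "walk i w \<in> borel_measurable (info {Inr (Inr x) | x. True})"
      unfolding walk_def[abs_def] by measurable
  qed auto
  then have D: "distr M borel (Y i) \<Otimes>\<^sub>M distr M borel (walk i w)
      = distr M (borel \<Otimes>\<^sub>M borel) (\<lambda>\<omega>. (Y i \<omega>, walk i w \<omega>))"
    by (simp add: indep_var_distribution_eq)
  interpret DY: prob_space "distr M borel (Y i)" by (rule prob_space_distr) simp
  interpret DW: prob_space "distr M borel (walk i w)" by (rule prob_space_distr) simp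
  interpret P: pair_sigma_finite "distr M borel (Y i)" "distr M borel (walk i w)" ..
  have "emeasure M {\<omega> \<in> space M. (Y i \<omega>, walk i w \<omega>) \<in> E}
      = emeasure (distr M (borel \<Otimes>\<^sub>M borel) (\<lambda>\<omega>. (Y i \<omega>, walk i w \<omega>))) E"
    using E by (subst emeasure_distr) (auto intro!: arg_cong[where f = "emeasure M"])
  also have "\<dots> = (\<integral>\<^sup>+s. emeasure (distr M borel (Y i)) ((\<lambda>y. (y, s)) -` E) \<partial>distr M borel (walk i w))"
    unfolding D[symmetric] using E by (intro P.emeasure_pair_measure_alt2) (simp cong: sets_pair_measure_cong)
  also have "\<dots> = (\<integral>\<^sup>+s. emeasure M {\<omega> \<in> space M. (Y i \<omega>, s) \<in> E} \<partial>distr M borel (walk i w))"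
  proof (intro nn_integral_cong)
    fix s
    have "(\<lambda>y. (y, s)) -` E \<in> sets borel" using E by (rule sets_Pair2)
    then show "emeasure (distr M borel (Y i)) ((\<lambda>y. (y, s)) -` E) = emeasure M {\<omega> \<in> space M. (Y i \<omega>, s) \<in> E}"
      by (subst emeasure_distr) (auto intro!: arg_cong[where f = "emeasure M"])
  qed
  finally show ?thesis by (simp add: distr_walk[OF n])
qed

section \<open>Poisson initial points, first moments and thinning\<close>

text \<open>The Poisson hypothesis speaks of the number of points in \<open>A\<close>, but
  independence of the families needs their indices. The event \<open>cnt A m\<close> is the
  countable disjoint union of the events \<open>occ A F\<close> over sets \<open>F\<close> of size
  \<open>m\<close>.\<close>

definition occ :: "(real^'d) set \<Rightarrow> nat set \<Rightarrow> 'a set" where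
  "occ A F = {\<omega> \<in> space M. {i. Y i \<omega> \<in> A} = F}"

definition cnt :: "(real^'d) set \<Rightarrow> nat \<Rightarrow> 'a set" where
  "cnt A m = {\<omega> \<in> space M. finite {i. Y i \<omega> \<in> A} \<and> card {i. Y i \<omega> \<in> A} = m}"

lemma occ_info: assumes [measurable]: "A \<in> sets borel" shows "occ A F \<in> sets (info {Inl ()})"
proof -
  have [measurable]: "Y i \<in> borel_measurable (info {Inl ()})" for i by (rule Y_measurable_info) simp
  have "Measurable.pred (info {Inl ()}) (\<lambda>\<omega>. \<forall>i. (Y i \<omega> \<in> A) = (i \<in> F))" by measurable
  moreover have "occ A F = {\<omega> \<in> space M. \<forall>i. (Y i \<omega> \<in> A) = (i \<in> F)}" by (auto simp: occ_def)
  ultimately show ?thesis by (simp add: pred_def)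
qed

lemma occ_event: "A \<in> sets borel \<Longrightarrow> occ A F \<in> events"
  using info_events[OF occ_info] .

lemma countable_finite_card: "countable {F :: nat set. finite F \<and> card F = m}"
  by (rule countable_subset[OF _ countable_Collect_finite]) auto

lemma cnt_eq: "cnt A m = (\<Union>F\<in>{F. finite F \<and> card F = m}. occ A F)"
  by (auto simp: cnt_def occ_def)

lemma cnt_event: "A \<in> sets borel \<Longrightarrow> cnt A m \<in> events"
  unfolding cnt_eq by (intro sets.countable_UN' countable_finite_card) (auto intro: occ_event)

lemma disjoint_cnt: "disjoint_family (cnt A)"
  by (auto simp: disjoint_family_on_def cnt_def)

lemma prob_cnt:
  assumes "A \<in> sets borel" "bounded A"
  shows "prob (cnt A m) = exp (- measure lborel A) * measure lborel A ^ m / fact m"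
  using poisson assms unfolding poisson_lebesgue_points_def cnt_def
  by (auto dest!: conjunct2 spec[of _ "1::nat"] spec[of _ "\<lambda>_::nat. A"] spec[of _ "\<lambda>_::nat. m"]
      simp: disjoint_family_on_def)

text \<open>The events \<open>cnt A m\<close> admit finite index sets only, and their Poisson
  probabilities already sum to 1.\<close>

lemma AE_finite_points:
  assumes "A \<in> sets borel" "bounded A" shows "AE \<omega> in M. finite {i. Y i \<omega> \<in> A}"
proof -
  have "(\<lambda>m. prob (cnt A m)) sums prob (\<Union>m. cnt A m)"
    using assms cnt_event disjoint_cnt by (intro finite_measure_UNION) auto
  moreover have "(\<lambda>m. prob (cnt A m)) sums 1"
    using poisson_pgf_sums[of "measure lborel A" 1] by (simp add: prob_cnt[OF assms])
  ultimately have "prob (\<Union>m. cnt A m) = 1" by (rule sums_unique2)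
  then have "AE \<omega> in M. \<omega> \<in> (\<Union>m. cnt A m)"
    using assms by (intro AE_prob_1)
  then show ?thesis by eventually_elim (auto simp: cnt_def)
qed

lemma emeasure_lborel_bounded:
  fixes A :: "(real^'d) set"
  assumes "bounded A" shows "emeasure lborel A = ennreal (measure lborel A)"
  using emeasure_bounded_finite[OF assms] by (intro emeasure_eq_ennreal_measure) auto

text \<open>Campbell's formula for an indicator: sum and expectation are exchanged, which leaves the
  mean of a Poisson count.\<close>

lemma intensity:
  assumes A: "A \<in> sets borel" "bounded A"
  shows "(\<Sum>i. emeasure M {\<omega> \<in> space M. Y i \<omega> \<in> A}) = emeasure lborel A"
proof -
  note [measurable] = A(1)
  have "(\<Sum>i. emeasure M {\<omega> \<in> space M. Y i \<omega> \<in> A})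
      = (\<Sum>i. \<integral>\<^sup>+\<omega>. indicator {\<omega> \<in> space M. Y i \<omega> \<in> A} \<omega> \<partial>M)"
    by (intro suminf_cong nn_integral_indicator[symmetric]) measurable
  also have "\<dots> = (\<integral>\<^sup>+\<omega>. (\<Sum>i. indicator {\<omega> \<in> space M. Y i \<omega> \<in> A} \<omega>) \<partial>M)"
    by (intro nn_integral_suminf[symmetric]) measurable
  also have "\<dots> = (\<integral>\<^sup>+\<omega>. (\<Sum>m. of_nat m * indicator (cnt A m) \<omega>) \<partial>M)"
  proof (intro nn_integral_cong_AE)
    show "AE \<omega> in M. (\<Sum>i. indicator {\<omega> \<in> space M. Y i \<omega> \<in> A} \<omega>) = (\<Sum>m. of_nat m * indicator (cnt A m) \<omega> :: ennreal)"
      using AE_finite_points[OF A] AE_space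
    proof eventually_elim
      case (elim \<omega>)
      let ?F = "{i. Y i \<omega> \<in> A}"
      have "(\<Sum>i. indicator {\<omega> \<in> space M. Y i \<omega> \<in> A} \<omega>) = (\<Sum>i\<in>?F. 1 :: ennreal)"
        using elim by (subst suminf_finite[of ?F]) auto
      moreover have "(\<Sum>m. of_nat m * indicator (cnt A m) \<omega> :: ennreal) = of_nat (card ?F)"
        using elim by (subst suminf_finite[of "{card ?F}"]) (auto simp: cnt_def)
      ultimately show ?case by simp
    qed
  qed
  also have "\<dots> = (\<Sum>m. of_nat m * emeasure M (cnt A m))"
    using cnt_event[OF A(1)] by (subst nn_integral_suminf) (auto simp: nn_integral_cmult_indicator)
  also have "\<dots> = (\<Sum>m. ennreal (real m * (exp (- measure lborel A) * measure lborel A ^ m / fact m)))"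
    by (intro suminf_cong)
      (simp only: emeasure_eq_measure prob_cnt[OF A] ennreal_of_nat_eq_real_of_nat ennreal_mult'[OF of_nat_0_le_iff])
  also have "\<dots> = ennreal (measure lborel A)"
    using poisson_mean_sums by (intro suminf_ennreal_eq) auto
  finally show ?thesis using emeasure_lborel_bounded[OF A(2)] by simp
qed

text \<open>A many-to-one formula combined with the union bound. Survival is independent of start
  and displacement, the sum over words is the mean population 1, and the sum over roots turns the
  law of the start into Lebesgue measure. Sections are bounded because the Poisson hypothesis
  concerns bounded sets.\<close>

lemma first_moment_bound:
  assumes n: "n > 0" and E: "E \<in> sets (borel \<Otimes>\<^sub>M borel)" and bd: "\<And>s. bounded {y. (y, s) \<in> E}"
  shows "emeasure M {\<omega> \<in> space M. \<exists>i w. length w = n \<and> brw_alive xi i w \<omega> \<and> (Y i \<omega>, walk i w \<omega>) \<in> E}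
      \<le> (\<integral>\<^sup>+s. emeasure lborel {y. (y, s) \<in> E} \<partial>walk_law n)"
proof -
  note [measurable] = E
  let ?A = "\<lambda>i w. {\<omega> \<in> space M. brw_alive xi i w \<omega> \<and> (Y i \<omega>, walk i w \<omega>) \<in> E}"
  let ?W = "{w :: nat list. length w = n}"
  let ?e = "\<lambda>i. (\<integral>\<^sup>+s. emeasure M {\<omega> \<in> space M. (Y i \<omega>, s) \<in> E} \<partial>walk_law n)"
  have one: "emeasure M (?A i w) = emeasure M {\<omega> \<in> space M. brw_alive xi i w \<omega>} * ?e i" if "w \<in> ?W" for i w
  proof -
    let ?J = "insert (Inl ()) {Inr (Inr x) | x. True}"
    have [measurable]: "Y i \<in> borel_measurable (info ?J)" by (rule Y_measurable_info) simp
    have [measurable]: "Xd x \<in> borel_measurable (info ?J)" for x by (rule Xd_measurable_info) auto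
    have [measurable]: "walk i w \<in> borel_measurable (info ?J)" unfolding walk_def[abs_def] by measurable
    have "Measurable.pred (info ?J) (\<lambda>\<omega>. (Y i \<omega>, walk i w \<omega>) \<in> E)" by measurable
    then have "{\<omega> \<in> space M. (Y i \<omega>, walk i w \<omega>) \<in> E} \<in> sets (info ?J)"
      unfolding pred_def space_info .
    then have "prob (?A i w) = prob {\<omega> \<in> space M. brw_alive xi i w \<omega>} * prob {\<omega> \<in> space M. (Y i \<omega>, walk i w \<omega>) \<in> E}"
      by (intro indep_info2[OF _ alive_info]) auto
    then show ?thesis
      using that n emeasure_start_walk[of w n E i, symmetric] by (simp add: emeasure_eq_measure ennreal_mult')
  qed
  have cntW: "countable ?W" by auto
  have "{\<omega> \<in> space M. \<exists>i w. length w = n \<and> brw_alive xi i w \<omega> \<and> (Y i \<omega>, walk i w \<omega>) \<in> E}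
      = (\<Union>i. \<Union>w\<in>?W. ?A i w)" by auto
  then have "emeasure M {\<omega> \<in> space M. \<exists>i w. length w = n \<and> brw_alive xi i w \<omega> \<and> (Y i \<omega>, walk i w \<omega>) \<in> E}
      = emeasure M (\<Union>i. \<Union>w\<in>?W. ?A i w)" by (rule arg_cong)
  also have "\<dots> \<le> (\<Sum>i. emeasure M (\<Union>w\<in>?W. ?A i w))"
  proof (rule emeasure_subadditive_countably)
    have "(\<Union>w\<in>?W. ?A i w) \<in> events" for i by (intro sets.countable_UN' cntW) auto
    then show "range (\<lambda>i. \<Union>w\<in>?W. ?A i w) \<subseteq> events" by blast
  qed
  also have "\<dots> \<le> (\<Sum>i. \<integral>\<^sup>+w. emeasure M (?A i w) \<partial>count_space ?W)"
    by (intro suminf_le emeasure_UN_le_nn_integral_count_space cntW summableI) measurable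
  also have "\<dots> = (\<Sum>i. (\<integral>\<^sup>+w. emeasure M {\<omega> \<in> space M. brw_alive xi i w \<omega>} * ?e i \<partial>count_space ?W))"
    using one by (intro suminf_cong nn_integral_cong) simp
  also have "\<dots> = (\<Sum>i. ?e i)"
    by (simp add: nn_integral_multc expected_population)
  also have "\<dots> = (\<integral>\<^sup>+s. (\<Sum>i. emeasure M {\<omega> \<in> space M. (Y i \<omega>, s) \<in> E}) \<partial>walk_law n)"
  proof (intro nn_integral_suminf[symmetric])
    fix i
    have "{x \<in> space (walk_law n \<Otimes>\<^sub>M M). (Y i (snd x), fst x) \<in> E} \<in> sets (walk_law n \<Otimes>\<^sub>M M)"
      unfolding walk_law_def by measurable
    from measurable_emeasure_Pair[OF this]
    show "(\<lambda>s. emeasure M {\<omega> \<in> space M. (Y i \<omega>, s) \<in> E}) \<in> borel_measurable (walk_law n)"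
      by (simp add: space_pair_measure walk_law_def vimage_def)
  qed
  also have "\<dots> = (\<integral>\<^sup>+s. emeasure lborel {y. (y, s) \<in> E} \<partial>walk_law n)"
  proof (intro nn_integral_cong)
    fix s
    have "(\<lambda>y. (y, s)) -` E \<in> sets borel" using E by (rule sets_Pair2)
    then show "(\<Sum>i. emeasure M {\<omega> \<in> space M. (Y i \<omega>, s) \<in> E}) = emeasure lborel {y. (y, s) \<in> E}"
      using intensity[of "{y. (y, s) \<in> E}"] bd[of s] by (simp add: vimage_def)
  qed
  finally show ?thesis .
qed

text \<open>Once the index set \<open>F\<close> of the points in \<open>A\<close> is fixed, its
  families die out independently of the points and of each other. Summing over all \<open>F\<close>
  of equal size and then over the size gives the Poisson generating function at the extinction
  probability.\<close>

lemma prob_all_dead: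
  assumes A: "A \<in> sets borel" "bounded A"
  shows "prob {\<omega> \<in> space M. \<forall>i. Y i \<omega> \<in> A \<longrightarrow> dead n i [] \<omega>}
      = exp (- brw_survival M xi n * measure lborel A)"
proof -
  note [measurable] = A(1)
  let ?d = "((\<lambda>s. \<Sum>k. p k * s ^ k) ^^ n) 0"
  let ?G = "{\<omega> \<in> space M. \<forall>i. Y i \<omega> \<in> A \<longrightarrow> dead n i [] \<omega>}"
  have d: "?d \<ge> 0" using measure_nonneg[of M] unfolding prob_dead[of n 0 "[]", symmetric] by blast
  have G: "?G \<in> events" by measurable
  have occ: "emeasure M (?G \<inter> occ A F) = emeasure M (occ A F) * ennreal (?d ^ card F)" if F: "finite F" for F
  proof -
    let ?I = "\<lambda>i. {Inr (Inl (i, [] @ u)) | u. True} :: (unit + (nat \<times> nat list) + (nat \<times> nat list)) set"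
    have "prob {\<omega> \<in> space M. \<forall>i\<in>F. dead n i [] \<omega>} = (\<Prod>i\<in>F. prob {\<omega> \<in> space M. dead n i [] \<omega>})"
      by (rule indep_info[where I = ?I, OF F _ dead_info]) (auto simp: disjoint_family_on_def)
    then have 1: "prob {\<omega> \<in> space M. \<forall>i\<in>F. dead n i [] \<omega>} = ?d ^ card F" by (simp add: prob_dead)
    have "{\<omega> \<in> space M. dead n i [] \<omega>} \<in> sets (info (\<Union>i. ?I i))" for i
      by (rule sets_info_mono[OF _ dead_info]) blast
    then have [measurable]: "Measurable.pred (info (\<Union>i. ?I i)) (dead n i [])" for i
      by (simp add: pred_def)
    have "Measurable.pred (info (\<Union>i. ?I i)) (\<lambda>\<omega>. \<forall>i\<in>F. dead n i [] \<omega>)" by measurable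
    then have 2: "{\<omega> \<in> space M. \<forall>i\<in>F. dead n i [] \<omega>} \<in> sets (info (\<Union>i. ?I i))"
      unfolding pred_def space_info .
    have "?G \<inter> occ A F = {\<omega> \<in> space M. {i. Y i \<omega> \<in> A} = F \<and> (\<forall>i\<in>F. dead n i [] \<omega>)}"
      by (auto simp: occ_def)
    also have "prob \<dots> = prob {\<omega> \<in> space M. {i. Y i \<omega> \<in> A} = F} * prob {\<omega> \<in> space M. \<forall>i\<in>F. dead n i [] \<omega>}"
      using occ_info[OF A(1), of F] by (intro indep_info2[OF _ _ 2, of "{Inl ()}"]) (auto simp: occ_def)
    finally show ?thesis
      using d by (simp add: 1 emeasure_eq_measure ennreal_mult' occ_def)
  qed
  have cnt: "prob (?G \<inter> cnt A m) = prob (cnt A m) * ?d ^ m" for m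
  proof -
    let ?F = "{F :: nat set. finite F \<and> card F = m}"
    have "emeasure M (?G \<inter> cnt A m) = emeasure M (\<Union>F\<in>?F. ?G \<inter> occ A F)"
      unfolding cnt_eq by (intro arg_cong[where f = "emeasure M"]) auto
    also have "\<dots> = (\<integral>\<^sup>+F. emeasure M (?G \<inter> occ A F) \<partial>count_space ?F)"
      using G occ_event[OF A(1)]
      by (intro emeasure_UN_countable countable_finite_card) (auto simp: disjoint_family_on_def occ_def)
    also have "\<dots> = (\<integral>\<^sup>+F. emeasure M (occ A F) * ennreal (?d ^ m) \<partial>count_space ?F)"
      by (intro nn_integral_cong) (simp add: occ)
    also have "\<dots> = (\<integral>\<^sup>+F. emeasure M (occ A F) \<partial>count_space ?F) * ennreal (?d ^ m)"
      by (simp add: nn_integral_multc)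
    also have "(\<integral>\<^sup>+F. emeasure M (occ A F) \<partial>count_space ?F) = emeasure M (cnt A m)"
      unfolding cnt_eq using occ_event[OF A(1)]
      by (intro emeasure_UN_countable[symmetric] countable_finite_card) (auto simp: disjoint_family_on_def occ_def)
    finally show ?thesis using d by (simp add: emeasure_eq_measure ennreal_mult'[symmetric])
  qed
  have "(\<lambda>m. prob (?G \<inter> cnt A m)) sums prob (\<Union>m. ?G \<inter> cnt A m)"
    using G cnt_event[OF A(1)] disjoint_cnt[of A]
    by (intro finite_measure_UNION) (auto simp: disjoint_family_on_def)
  moreover have "prob (\<Union>m. ?G \<inter> cnt A m) = prob ?G"
  proof (rule finite_measure_eq_AE)
    show "AE \<omega> in M. (\<omega> \<in> (\<Union>m. ?G \<inter> cnt A m)) = (\<omega> \<in> ?G)"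
      using AE_finite_points[OF A] by eventually_elim (auto simp: cnt_def)
    show "(\<Union>m. ?G \<inter> cnt A m) \<in> events" using G cnt_event[OF A(1)] by auto
  qed (rule G)
  moreover have "(\<lambda>m. prob (?G \<inter> cnt A m)) sums exp (- (1 - ?d) * measure lborel A)"
    unfolding cnt prob_cnt[OF A] by (rule poisson_pgf_sums)
  ultimately show ?thesis by (simp add: survival_eq sums_unique2)
qed

subsection \<open>Vacant balls\<close>

definition vacant :: "nat \<Rightarrow> real \<Rightarrow> 'a set" where
  "vacant n \<rho> = {\<omega> \<in> space M. \<forall>i w. length w = n \<longrightarrow> brw_alive xi i w \<omega> \<longrightarrow> brw_position Y Xd i w \<omega> \<notin> ball 0 \<rho>}"

text \<open>The word \<open>replicate n 0\<close> is a representative: displacements are attached to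
  all words, alive or not, and their sum has a law depending on the length only.\<close>

definition far :: "nat \<Rightarrow> real \<Rightarrow> real" where
  "far n c = prob {\<omega> \<in> space M. norm (walk 0 (replicate n 0) \<omega>) > c}"

lemma walk_law_eq: "n > 0 \<Longrightarrow> walk_law n = distr M borel (walk 0 (replicate n 0))"
  by (rule distr_walk[symmetric]) auto

text \<open>The centre \<open>z\<close> may depend on the displacement \<open>s\<close>, since
  translates of a ball have equal volume. This serves both for lines selected by their start and for
  lines selected by their end.\<close>

lemma first_moment_far:
  assumes n: "n > 0" and E: "E \<in> sets (borel \<Otimes>\<^sub>M borel)"
    and sec: "\<And>s. \<exists>z. {y. (y, s) \<in> E} \<subseteq> (if norm s > c then ball z \<rho> else {})" and \<rho>: "\<rho> \<ge> 0"
  shows "prob {\<omega> \<in> space M. \<exists>i w. length w = n \<and> brw_alive xi i w \<omega> \<and> (Y i \<omega>, walk i w \<omega>) \<in> E}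
      \<le> measure lborel (ball (0 :: real^'d) \<rho>) * far n c"
proof -
  let ?v = "measure lborel (ball (0 :: real^'d) \<rho>)"
  have bd: "bounded {y. (y, s) \<in> E}" for s
    using sec[of s] bounded_subset[OF bounded_ball] by (auto split: if_splits)
  have le: "emeasure lborel {y. (y, s) \<in> E} \<le> ennreal ?v * indicator {s. norm s > c} s" for s
  proof -
    obtain z where z: "{y. (y, s) \<in> E} \<subseteq> (if norm s > c then ball z \<rho> else {})" using sec by blast
    show ?thesis
    proof (cases "norm s > c")
      case True
      then have "emeasure lborel {y. (y, s) \<in> E} \<le> emeasure lborel (ball z \<rho>)"
        using z by (intro emeasure_mono) auto
      also have "\<dots> = ennreal ?v" using \<rho> by (simp add: emeasure_ball content_ball)
      finally show ?thesis using True by simp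
    next
      case False
      then have "{y. (y, s) \<in> E} = {}" using z by auto
      then show ?thesis by simp
    qed
  qed
  have "ennreal (prob {\<omega> \<in> space M. \<exists>i w. length w = n \<and> brw_alive xi i w \<omega> \<and> (Y i \<omega>, walk i w \<omega>) \<in> E})
     \<le> (\<integral>\<^sup>+s. emeasure lborel {y. (y, s) \<in> E} \<partial>walk_law n)"
    using first_moment_bound[OF n E bd] by (simp add: emeasure_eq_measure)
  also have "\<dots> \<le> (\<integral>\<^sup>+s. ennreal ?v * indicator {s. norm s > c} s \<partial>walk_law n)"
    by (intro nn_integral_mono le)
  also have "\<dots> = ennreal ?v * emeasure (walk_law n) {s. norm s > c}"
    by (intro nn_integral_cmult_indicator) (simp add: walk_law_def)
  also have "emeasure (walk_law n) {s. norm s > c} = ennreal (far n c)"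
    unfolding walk_law_eq[OF n] far_def emeasure_eq_measure[symmetric]
    by (subst emeasure_distr) (auto intro!: arg_cong[where f = "emeasure M"])
  also have "ennreal ?v * ennreal (far n c) = ennreal (?v * far n c)" by (simp add: ennreal_mult')
  finally show ?thesis by (simp add: far_def)
qed

lemma far_event:
  assumes [measurable]: "E \<in> sets (borel \<Otimes>\<^sub>M borel)"
  shows "{\<omega> \<in> space M. \<exists>i w. length w = n \<and> brw_alive xi i w \<omega> \<and> (Y i \<omega>, walk i w \<omega>) \<in> E} \<in> events"
  by measurable

lemma vacant_event: "vacant n \<rho> \<in> events"
proof -
  have [measurable]: "Measurable.pred M (\<lambda>\<omega>. Y i \<omega> + walk i w \<omega> \<in> ball 0 \<rho>)" for i w
    by (rule pred_sets2[of _ borel]) auto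
  have "Measurable.pred M (\<lambda>\<omega>. \<forall>i w. length w = n \<longrightarrow> brw_alive xi i w \<omega> \<longrightarrow> \<not> Y i \<omega> + walk i w \<omega> \<in> ball 0 \<rho>)"
    by (intro pred_intros_countable pred_intros_logic) auto
  then show ?thesis by (simp add: vacant_def position_eq pred_def)
qed

lemma all_dead_event:
  assumes [measurable]: "A \<in> sets borel"
  shows "{\<omega> \<in> space M. \<forall>i. Y i \<omega> \<in> A \<longrightarrow> dead n i [] \<omega>} \<in> events"
  by measurable

text \<open>A surviving family from the inner ball can leave the ball of radius
  \<open>\<rho>\<close> only by displacements larger than \<open>c\<close>. The offending lines
  start in a bounded set and are counted there.\<close>

lemma prob_vacant_upper:
  assumes n: "n > 0" and c: "c > 0" "c < \<rho>"
  shows "prob (vacant n \<rho>) \<le> exp (- brw_survival M xi n * measure lborel (ball (0 :: real^'d) (\<rho> - c)))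
    + measure lborel (ball (0 :: real^'d) (\<rho> - c)) * far n c"
proof -
  let ?E = "{(y, s). y \<in> ball (0 :: real^'d) (\<rho> - c) \<and> norm (s :: real^'d) > c}"
  let ?G = "{\<omega> \<in> space M. \<forall>i. Y i \<omega> \<in> ball 0 (\<rho> - c) \<longrightarrow> dead n i [] \<omega>}"
  let ?B = "{\<omega> \<in> space M. \<exists>i w. length w = n \<and> brw_alive xi i w \<omega> \<and> (Y i \<omega>, walk i w \<omega>) \<in> ?E}"
  have E: "?E \<in> sets (borel \<Otimes>\<^sub>M borel)"
  proof -
    have "?E = {x. norm (fst x) < (\<rho> - c) \<and> c < norm (snd x)}" by auto
    then show ?thesis unfolding borel_prod
      by (auto intro!: borel_open open_Collect_conj open_Collect_less continuous_intros)
  qed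
  have "vacant n \<rho> \<subseteq> ?G \<union> ?B"
  proof (rule subsetI, rule UnCI)
    fix \<omega> assume v: "\<omega> \<in> vacant n \<rho>" and B: "\<omega> \<notin> ?B"
    have "dead n i [] \<omega>" if "Y i \<omega> \<in> ball 0 (\<rho> - c)" for i
    proof (rule ccontr)
      assume "\<not> dead n i [] \<omega>"
      then obtain w where w: "length w = n" "brw_alive xi i w \<omega>" by (auto simp: dead_root_iff)
      have "norm (walk i w \<omega>) \<le> c"
      proof (rule ccontr)
        assume "\<not> ?thesis"
        then have "(Y i \<omega>, walk i w \<omega>) \<in> ?E" using that by auto
        then have "\<omega> \<in> ?B" using w v unfolding vacant_def by blast
        then show False using B by contradiction
      qed
      then have "norm (Y i \<omega> + walk i w \<omega>) < \<rho>"
        using that norm_triangle_ineq[of "Y i \<omega>" "walk i w \<omega>"] by simp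
      then show False using v w by (auto simp: vacant_def position_eq)
    qed
    then show "\<omega> \<in> ?G" using v by (auto simp: vacant_def)
  qed
  then have "prob (vacant n \<rho>) \<le> prob (?G \<union> ?B)"
    by (intro finite_measure_mono sets.Un all_dead_event far_event[OF E]) auto
  also have "\<dots> \<le> prob ?G + prob ?B"
    by (intro measure_Un_le all_dead_event far_event[OF E]) auto
  also have "prob ?G = exp (- brw_survival M xi n * measure lborel (ball (0 :: real^'d) (\<rho> - c)))"
    by (rule prob_all_dead) auto
  also have "prob ?B \<le> measure lborel (ball (0 :: real^'d) (\<rho> - c)) * far n c"
    using c by (intro first_moment_far n E exI[of _ 0]) auto
  finally show ?thesis by simp
qed

text \<open>Intruders may start arbitrarily far away, so they are selected by their end point: for a
  given displacement \<open>s\<close> their starts fill the ball of radius \<open>\<rho>\<close>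
  around \<open>- s\<close>.\<close>

lemma prob_vacant_lower:
  assumes n: "n > 0" and c: "c > 0" "\<rho> > 0"
  shows "prob (vacant n \<rho>) \<ge> exp (- brw_survival M xi n * measure lborel (ball (0 :: real^'d) (\<rho> + c)))
    - measure lborel (ball (0 :: real^'d) \<rho>) * far n c"
proof -
  let ?E = "{(y, s). y + s \<in> ball (0 :: real^'d) \<rho> \<and> norm (s :: real^'d) > c}"
  let ?G = "{\<omega> \<in> space M. \<forall>i. Y i \<omega> \<in> ball 0 (\<rho> + c) \<longrightarrow> dead n i [] \<omega>}"
  let ?B = "{\<omega> \<in> space M. \<exists>i w. length w = n \<and> brw_alive xi i w \<omega> \<and> (Y i \<omega>, walk i w \<omega>) \<in> ?E}"
  have E: "?E \<in> sets (borel \<Otimes>\<^sub>M borel)"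
  proof -
    have "?E = {x. norm (fst x + snd x) < (\<rho>) \<and> c < norm (snd x)}" by auto
    then show ?thesis unfolding borel_prod
      by (auto intro!: borel_open open_Collect_conj open_Collect_less continuous_intros)
  qed
  have "?G \<subseteq> vacant n \<rho> \<union> ?B"
  proof (rule subsetI, rule UnCI)
    fix \<omega> assume G: "\<omega> \<in> ?G" and B: "\<omega> \<notin> ?B"
    have "brw_position Y Xd i w \<omega> \<notin> ball 0 \<rho>" if w: "length w = n" "brw_alive xi i w \<omega>" for i w
    proof
      assume "brw_position Y Xd i w \<omega> \<in> ball 0 \<rho>"
      then have in_ball: "norm (Y i \<omega> + walk i w \<omega>) < \<rho>" by (simp add: position_eq)
      have "\<not> dead n i [] \<omega>" using w by (auto simp: dead_root_iff)
      then have "norm (Y i \<omega>) \<ge> \<rho> + c" using G by (auto simp: not_less[symmetric])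
      then have "norm (walk i w \<omega>) > c"
        using in_ball norm_triangle_ineq4[of "Y i \<omega> + walk i w \<omega>" "walk i w \<omega>"] by simp
      then show False using B G w in_ball by auto
    qed
    then show "\<omega> \<in> vacant n \<rho>" using G by (auto simp: vacant_def)
  qed
  then have "prob ?G \<le> prob (vacant n \<rho> \<union> ?B)"
    by (intro finite_measure_mono sets.Un vacant_event far_event[OF E]) auto
  also have "\<dots> \<le> prob (vacant n \<rho>) + prob ?B"
    by (intro measure_Un_le vacant_event far_event[OF E])
  also have "prob ?B \<le> measure lborel (ball (0 :: real^'d) \<rho>) * far n c"
  proof (intro first_moment_far n E)
    fix s :: "real^'d"
    have "{y. (y, s) \<in> ?E} \<subseteq> (if norm s > c then ball (- s) \<rho> else {})"
    proof -
      have "dist (- s) y = norm (y + s)" for y by (metis dist_norm norm_minus_commute diff_minus_eq_add)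
      then show ?thesis by auto
    qed
    then show "\<exists>z. {y. (y, s) \<in> ?E} \<subseteq> (if norm s > c then ball z \<rho> else {})" by blast
  qed (use c in auto)
  also have "prob ?G = exp (- brw_survival M xi n * measure lborel (ball (0 :: real^'d) (\<rho> + c)))"
    by (rule prob_all_dead) auto
  finally show ?thesis by simp
qed

lemma integrable_disp:
  fixes h :: "real^'d \<Rightarrow> 'c :: {banach, second_countable_topology}"
  assumes [measurable]: "h \<in> borel_measurable borel" and "integrable M (\<lambda>\<omega>. h (Xd (0, []) \<omega>))"
  shows "integrable M (\<lambda>\<omega>. h (Xd x \<omega>))"
    and "expectation (\<lambda>\<omega>. h (Xd x \<omega>)) = expectation (\<lambda>\<omega>. h (Xd (0, []) \<omega>))"
proof -
  have "integrable (distr M borel (Xd x)) h"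
    unfolding disp_ident[of x] using assms(2) by (subst integrable_distr_eq) auto
  then show "integrable M (\<lambda>\<omega>. h (Xd x \<omega>))" by (subst (asm) integrable_distr_eq) auto
  have "expectation (\<lambda>\<omega>. h (Xd x \<omega>)) = (\<integral>y. h y \<partial>distr M borel (Xd x))"
    by (subst integral_distr) auto
  also have "\<dots> = expectation (\<lambda>\<omega>. h (Xd (0, []) \<omega>))"
    unfolding disp_ident[of x] by (subst integral_distr) auto
  finally show "expectation (\<lambda>\<omega>. h (Xd x \<omega>)) = expectation (\<lambda>\<omega>. h (Xd (0, []) \<omega>))" .
qed

text \<open>Two moments of one step are used: order \<alpha> bounds a single large jump by Markov's
  inequality, and order \<kappa> \<le> 2 bounds the remainder in the truncated exponential
  moment.\<close>

lemma far_bound: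
  assumes int: "integrable M (Xd (0, []))" and zero: "expectation (Xd (0, [])) = 0"
    and moment: "integrable M (\<lambda>\<omega>. norm (Xd (0, []) \<omega>) powr \<alpha>)"
    and par: "0 < t" "0 < \<theta>" "1 \<le> \<kappa>" "\<kappa> \<le> 2" "\<kappa> \<le> \<alpha>"
  shows "far n (real CARD('d) * x) \<le> 2 * real CARD('d) *
    (real n * (expectation (\<lambda>\<omega>. norm (Xd (0, []) \<omega>) powr \<alpha>) / t powr \<alpha>)
      + exp (- \<theta> * x + real n * (\<theta> powr \<kappa> * exp (\<theta> * t) * expectation (\<lambda>\<omega>. norm (Xd (0, []) \<omega>) powr \<kappa>))))"
proof -
  let ?w = "replicate n 0 :: nat list"
  have k: "integrable M (\<lambda>\<omega>. norm (Xd (0, []) \<omega>) powr \<kappa>)"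
  proof (rule Bochner_Integration.integrable_bound)
    show "integrable M (\<lambda>\<omega>. 1 + norm (Xd (0, []) \<omega>) powr \<alpha>)" using moment by simp
    have "u powr \<kappa> \<le> 1 + u powr \<alpha>" if "u \<ge> 0" for u :: real
    proof (cases "u \<le> 1")
      case True
      then show ?thesis using that par powr_le1[of \<kappa> u] by (simp add: add_increasing2)
    next
      case False
      then show ?thesis using powr_mono[OF par(5), of u] by linarith
    qed
    then show "AE \<omega> in M. norm (norm (Xd (0, []) \<omega>) powr \<kappa>) \<le> norm (1 + norm (Xd (0, []) \<omega>) powr \<alpha>)"
      by (auto simp: add_nonneg_nonneg)
  qed measurable
  have "prob {\<omega> \<in> space M. norm (\<Sum>j\<in>{1..n}. Xd (0, take j ?w) \<omega>) > real CARD('d) * x}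
    \<le> 2 * real CARD('d) * (real (card {1..n}) * (expectation (\<lambda>\<omega>. norm (Xd (0, []) \<omega>) powr \<alpha>) / t powr \<alpha>)
      + exp (- \<theta> * x + real (card {1..n}) * (\<theta> powr \<kappa> * exp (\<theta> * t) * expectation (\<lambda>\<omega>. norm (Xd (0, []) \<omega>) powr \<kappa>))))"
  proof (rule norm_sum_tail)
    show "indep_vars (\<lambda>_. borel) (\<lambda>j. Xd (0, take j ?w)) {1..n}" using indep_steps[of 0 ?w] by simp
    fix j
    show "integrable M (Xd (0, take j ?w))" "expectation (Xd (0, take j ?w)) = 0"
      using integrable_disp[of "\<lambda>y. y" "(0, take j ?w)"] int zero by auto
    show "integrable M (\<lambda>\<omega>. norm (Xd (0, take j ?w) \<omega>) powr \<kappa>)"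
      "expectation (\<lambda>\<omega>. norm (Xd (0, take j ?w) \<omega>) powr \<kappa>) \<le> expectation (\<lambda>\<omega>. norm (Xd (0, []) \<omega>) powr \<kappa>)"
      using integrable_disp[of "\<lambda>y. norm y powr \<kappa>" "(0, take j ?w)"] k by auto
    have "prob {\<omega> \<in> space M. norm (Xd (0, take j ?w) \<omega>) > t}
        \<le> expectation (\<lambda>\<omega>. norm (Xd (0, take j ?w) \<omega>) powr \<alpha>) / t powr \<alpha>"
      using integrable_disp(1)[of "\<lambda>y. norm y powr \<alpha>" "(0, take j ?w)"] moment par
      by (intro norm_tail_powr) auto
    then show "prob {\<omega> \<in> space M. norm (Xd (0, take j ?w) \<omega>) > t}
        \<le> expectation (\<lambda>\<omega>. norm (Xd (0, []) \<omega>) powr \<alpha>) / t powr \<alpha>"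
      using integrable_disp(2)[of "\<lambda>y. norm y powr \<alpha>" "(0, take j ?w)"] moment by simp
  qed (use par in auto)
  then show ?thesis by (simp add: far_def walk_def)
qed

end

section \<open>The limit law\<close>

lemma convex_on_add_affine:
  fixes f :: "real \<Rightarrow> real"
  assumes "convex_on S f" shows "convex_on S (\<lambda>u. f u + (u - 1))"
proof -
  have "convex_on S (\<lambda>u::real. u - 1)"
    using convex_on_imp_convex[OF assms] by (simp add: convex_on_def algebra_simps)
  then show ?thesis by (intro convex_on_add assms)
qed

theorem theorem1p4:
  fixes M :: "'a measure"
    and p :: "nat \<Rightarrow> real" and L :: "real \<Rightarrow> real" and \<beta> \<alpha> :: real
    and Y :: "nat \<Rightarrow> 'a \<Rightarrow> real^'d"
    and xi :: "nat \<times> nat list \<Rightarrow> 'a \<Rightarrow> nat"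
    and Xd :: "nat \<times> nat list \<Rightarrow> 'a \<Rightarrow> real^'d"
  assumes M: "prob_space M"
    and p_nonneg: "\<And>k. p k \<ge> 0" and p_sum: "p sums 1"
    and p0: "p 0 < 1" and p1: "p 1 < 1"
    and mean: "(\<lambda>k. real k * p k) sums 1"
    and beta: "0 < \<beta>" "\<beta> \<le> 1 / real CARD('d)"
    and L_sv: "\<And>x. 0 < x \<Longrightarrow> x \<le> 1 \<Longrightarrow> ((\<lambda>s. L (s * x) / L s) \<longlongrightarrow> 1) (at_right 0)"
    and gen_fun: "\<And>s. 0 \<le> s \<Longrightarrow> s \<le> 1 \<Longrightarrow>
                    (\<Sum>k. p k * s ^ k) = s + (1 - s) powr (1 + \<beta>) * L (1 - s)"
    and poisson: "poisson_lebesgue_points M Y"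
    and offspring: "\<And>x k. measure M {\<omega> \<in> space M. xi x \<omega> = k} = p k"
    and disp_meas: "\<And>x. Xd x \<in> borel_measurable M"
    and disp_ident: "\<And>x. distr M borel (Xd x) = distr M borel (Xd (0, []))"
    and comp_indep: "prob_space.indep_vars M (\<lambda>_. borel) (\<lambda>j \<omega>. Xd (0, []) \<omega> $ j) UNIV"
    and comp_ident: "\<And>j j'. distr M borel (\<lambda>\<omega>. Xd (0, []) \<omega> $ j) = distr M borel (\<lambda>\<omega>. Xd (0, []) \<omega> $ j')"
    and disp_mean: "integrable M (Xd (0, []))" "integral\<^sup>L M (Xd (0, [])) = 0"
    and moment: "integrable M (\<lambda>\<omega>. norm (Xd (0, []) \<omega>) powr \<alpha>)"
    and alpha: "\<alpha> > (\<beta> + 1) * real CARD('d)"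
    and indep: "brw_independent M Y xi Xd"
    and r: "r > 0"
  shows "(\<lambda>n. measure M {\<omega> \<in> space M.
             brw_radius xi Y Xd n \<omega> / ereal ((real n * L (brw_survival M xi n)) powr (1 / (\<beta> * real CARD('d))))
               \<ge> ereal r})
         \<longlonglongrightarrow> exp (- ball_volume CARD('d) r * (1 / \<beta>) powr (1 / \<beta>))"
proof -
  interpret prob_space M by fact
  interpret B: branching_random_walk M p Y xi Xd
    by unfold_locales (fact p_nonneg mean poisson offspring disp_meas disp_ident indep)+
  define f where "f s = (\<Sum>k. p k * s ^ k)" for s
  \<comment> \<open>Defined through \<open>f\<close>, so that convexity is that of a power series;
    the expression in terms of \<open>L\<close> is available on the unit interval.\<close>
  define \<phi> where "\<phi> u = f (1 - u) + (u - 1)" for u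
  define q where "q = brw_survival M xi"
  define d where "d = real CARD('d)"
  define b where "b n = (real n * L (q n)) powr (1 / (\<beta> * d))" for n
  have d: "d \<ge> 1" "d > 0" by (auto simp: d_def Suc_le_eq)
  have \<phi>_L: "\<phi> u = u powr (1 + \<beta>) * L u" if "0 \<le> u" "u \<le> 1" for u
    using gen_fun[of "1 - u"] that by (simp add: \<phi>_def f_def)
  have iter: "0 \<le> (f ^^ n) 0 \<and> (f ^^ n) 0 < 1" for n
  proof (induction n)
    case (Suc n)
    have "f ((f ^^ n) 0) < 1" "(f ^^ n) 0 \<le> f ((f ^^ n) 0)"
      using Suc unfolding f_def[of "(f ^^ n) 0"]
      by (auto intro!: pgf_lt_1 critical_pgf_ge p_nonneg p_sum p0 mean)
    then show ?case using Suc by simp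
  qed simp
  have q_eq: "q n = 1 - (f ^^ n) 0" for n by (simp add: q_def B.survival_eq f_def[abs_def])
  interpret Q: critical_iteration \<phi> \<beta> q
  proof
    show "convex_on {0..1} \<phi>"
      unfolding \<phi>_def[abs_def] f_def[abs_def]
      by (intro convex_on_add_affine convex_on_pgf p_nonneg sums_summable[OF p_sum])
    show "\<phi> 0 = 0" using \<phi>_L[of 0] by simp
    show "0 \<le> \<phi> u" if "0 \<le> u" "u \<le> 1" for u
      using critical_pgf_ge[OF p_nonneg p_sum mean, of "1 - u"] that by (simp add: \<phi>_def f_def)
    show "((\<lambda>s. \<phi> (s * x) / \<phi> s) \<longlongrightarrow> x powr (1 + \<beta>)) (at_right 0)" if x: "0 < x" "x \<le> 1" for x
    proof -
      have "((\<lambda>s. x powr (1 + \<beta>) * (L (s * x) / L s)) \<longlongrightarrow> x powr (1 + \<beta>) * 1) (at_right 0)"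
        by (intro tendsto_mult_left L_sv x)
      moreover have "eventually (\<lambda>s::real. 0 < s \<and> s < 1) (at_right 0)"
        by (auto simp: eventually_at_right[of 0 1] intro: exI[of _ 1])
      then have "eventually (\<lambda>s. x powr (1 + \<beta>) * (L (s * x) / L s) = \<phi> (s * x) / \<phi> s) (at_right 0)"
      proof eventually_elim
        case (elim s)
        then have "s * x \<le> 1" using x by (simp add: mult_le_one)
        then show ?case using elim x by (simp add: \<phi>_L powr_mult)
      qed
      ultimately show ?thesis by (simp add: tendsto_cong)
    qed
    show "q n > 0" "q n \<le> 1" for n using iter[of n] by (auto simp: q_eq)
    show "q (Suc n) = q n - \<phi> (q n)" for n by (simp add: q_eq \<phi>_def)
  qed (fact beta)
  have q01: "0 < q n" "q n \<le> 1" for n by (rule Q.q_pos, rule Q.q_le_1)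
  have g_eq: "Q.g (q n) = q n powr \<beta> * L (q n)" for n
    using q01[of n] by (simp add: Q.g_def \<phi>_L powr_add)
  have L_pos: "L (q n) > 0" for n
    using Q.g_pos[OF q01] q01[of n] by (simp add: g_eq zero_less_mult_iff)
  have b_pos: "b n > 0" if "n > 0" for n using L_pos[of n] that by (simp add: b_def)
  have b_nonneg: "b n \<ge> 0" for n by (simp add: b_def)
  define C where "C = (1 / \<beta>) powr (1 / \<beta>)"
  have C: "C > 0" using beta by (simp add: C_def)
  \<comment> \<open>The exponent in \<open>b n\<close> makes \<open>b n powr d\<close> equal to
    \<open>(n * L (q n)) powr (1 / \<beta>)\<close>, and writing \<open>q n\<close> as
    \<open>(q n powr \<beta>) powr (1 / \<beta>)\<close> completes \<open>g (q n)\<close>.\<close>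
  have qb_eq: "q n * b n powr d = (real n * Q.g (q n)) powr (1 / \<beta>)" for n
    using q01[of n] L_pos[of n] beta(1) d by (simp add: b_def g_eq powr_powr powr_mult)
  have qb: "(\<lambda>n. q n * b n powr d) \<longlonglongrightarrow> C"
    unfolding qb_eq C_def using beta by (intro tendsto_powr Q.g_q_asymp tendsto_const) auto
  have bd_top: "filterlim (\<lambda>n. b n powr d) at_top sequentially"
  proof -
    have "filterlim (\<lambda>n. (q n * b n powr d) * inverse (q n)) at_top sequentially"
      using filterlim_compose[OF filterlim_inverse_at_top_right Q.q_at_right_0]
      by (rule filterlim_tendsto_pos_mult_at_top[OF qb C])
    then show ?thesis using q01(1)[THEN less_imp_neq] by (simp add: field_simps)
  qed
  have b_top: "filterlim b at_top sequentially"
  proof -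
    have "filterlim (\<lambda>n. (b n powr d) powr (1 / d)) at_top sequentially"
    proof -
      have "filterlim (\<lambda>x::real. x powr (1 / d)) at_top at_top" using d by real_asymp
      from filterlim_compose[OF this bd_top] show ?thesis .
    qed
    moreover have "(b n powr d) powr (1 / d) = b n" for n
      using d by (simp add: powr_powr b_nonneg)
    ultimately show ?thesis by simp
  qed
  \<comment> \<open>Since \<open>q n * b n powr d\<close> has a positive limit,
    \<open>b n powr (- k)\<close> may be traded for \<open>q n powr (k / d)\<close>, and
    \<open>k / d\<close> exceeds \<beta>.\<close>
  have nb: "(\<lambda>n. real n * b n powr (- k)) \<longlonglongrightarrow> 0" if k: "k > \<beta> * d" for k
  proof -
    have "k / d > \<beta>" using k d by (simp add: field_simps)
    then have "(\<lambda>n. real n * q n powr (k / d) * (q n * b n powr d) powr (- k / d)) \<longlonglongrightarrow> 0 * C powr (- k / d)"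
      using C by (intro tendsto_mult Q.index_times_powr_tendsto_0 tendsto_powr qb tendsto_const) auto
    moreover have "q n powr (k / d) * (q n * b n powr d) powr (- k / d) = b n powr (- k)" for n
      using q01[of n] d by (simp add: powr_mult powr_powr powr_minus b_nonneg)
    ultimately show ?thesis by (simp add: mult.assoc)
  qed
  \<comment> \<open>The Taylor bound needs an exponent between 1 and 2, integrability one up to
    \<alpha>, and the tail estimate one above \<beta> d. They are compatible because \<beta> d \<le>
    1 and \<alpha> > \<beta> d + d.\<close>
  define \<kappa> where "\<kappa> = min \<alpha> 2"
  have bd: "\<beta> * d \<le> 1" using beta d by (simp add: d_def field_simps)
  have \<alpha>: "\<alpha> > \<beta> * d + d" using alpha by (simp add: d_def algebra_simps)
  have "\<beta> * d > 0" using beta d by simp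
  then have \<kappa>: "\<kappa> > \<beta> * d" "\<kappa> > 0" "1 \<le> \<kappa>" "\<kappa> \<le> 2" "\<kappa> \<le> \<alpha>" using bd d \<alpha> by (auto simp: \<kappa>_def)
  have far_0: "(\<lambda>n. b n powr d * B.far n (e * b n)) \<longlonglongrightarrow> 0" if e: "e > 0" for e
  proof -
    define m' where "m' = expectation (\<lambda>\<omega>. norm (Xd (0, []) \<omega>) powr \<alpha>)"
    define m where "m = expectation (\<lambda>\<omega>. norm (Xd (0, []) \<omega>) powr \<kappa>)"
    \<comment> \<open>Compensates the dimension factor lost in passing from the norm to single
      coordinates.\<close>
    define c where "c = e / d"
    have c: "c > 0" using e d by (simp add: c_def)
    define \<theta> where "\<theta> n = (d + 1) * ln (b n) / (c * b n)" for n
    obtain \<delta> where \<delta>: "\<delta> > 0" and lim: "(\<lambda>n. b n powr d * (real n * (m' / (\<delta> * b n) powr \<alpha>) +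
        exp (- \<theta> n * (c * b n) + real n * (\<theta> n powr \<kappa> * exp (\<theta> n * (\<delta> * b n)) * m)))) \<longlonglongrightarrow> 0" (is "?F \<longlonglongrightarrow> 0")
      using truncated_tail_bound_tendsto_0[OF b_top nb \<kappa>(1,2) \<alpha> c d(2), of m' m] unfolding \<theta>_def by blast
    show ?thesis
    proof (rule tendsto_sandwich[OF _ _ tendsto_const])
      show "(\<lambda>n. 2 * d * ?F n) \<longlonglongrightarrow> 0" using tendsto_mult_left[OF lim, of "2 * d"] by simp
      show "eventually (\<lambda>n. 0 \<le> b n powr d * B.far n (e * b n)) sequentially"
        by (simp add: B.far_def)
      \<comment> \<open>Once \<open>b n > 1\<close>, its logarithm is positive and so is the
        parameter \<open>\<theta> n\<close>.\<close>
      show "eventually (\<lambda>n. b n powr d * B.far n (e * b n) \<le> 2 * d * ?F n) sequentially"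
        using filterlim_at_top_dense[THEN iffD1, OF b_top, rule_format, of 1]
      proof eventually_elim
        case (elim n)
        have "\<theta> n > 0" using elim c d by (simp add: \<theta>_def)
        then have "B.far n (real CARD('d) * (c * b n)) \<le> 2 * real CARD('d) * (real n * (m' / (\<delta> * b n) powr \<alpha>) +
            exp (- \<theta> n * (c * b n) + real n * (\<theta> n powr \<kappa> * exp (\<theta> n * (\<delta> * b n)) * m)))"
          unfolding m_def m'_def using elim \<delta> \<kappa>
          by (intro B.far_bound disp_mean moment) auto
        moreover have "real CARD('d) * (c * b n) = e * b n" using d by (simp add: c_def d_def)
        ultimately have "B.far n (e * b n) \<le> 2 * d * (real n * (m' / (\<delta> * b n) powr \<alpha>) +
            exp (- \<theta> n * (c * b n) + real n * (\<theta> n powr \<kappa> * exp (\<theta> n * (\<delta> * b n)) * m)))"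
          by (simp add: d_def)
        from mult_left_mono[OF this, of "b n powr d"] show ?case by (simp add: mult_ac)
      qed
    qed
  qed
  define V where "V = unit_ball_vol d"
  have vol: "measure lborel (ball (0 :: real^'d) (x * b n)) = V * x ^ CARD('d) * b n powr d"
    if "x \<ge> 0" "n > 0" for x n
    using that b_pos[of n] by (simp add: content_ball V_def d_def powr_realpow power_mult_distrib)
  define P where "P n = prob (B.vacant n (r * b n))" for n
  have P_eq: "measure M {\<omega> \<in> space M. brw_radius xi Y Xd n \<omega> / ereal (b n) \<ge> ereal r} = P n" if "n > 0" for n
    unfolding P_def B.vacant_def radius_ge_iff[OF b_pos[OF that] r] ..
  let ?h = "\<lambda>x. exp (- (V * x ^ CARD('d) * C))"
  have cont: "isCont ?h r" by (intro continuous_intros)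
  have "P \<longlonglongrightarrow> ?h r"
  proof (rule order_tendstoI)
    fix a assume a: "?h r < a"
    \<comment> \<open>The slack between the radii is a fixed multiple of \<open>b n\<close> while
      \<open>n\<close> grows; continuity of the limit in the radius lets a multiple be chosen that
      still keeps it below \<open>a\<close>.\<close>
    have e1: "eventually (\<lambda>x. ?h x < a) (at_left r)"
      using order_tendstoD(2)[OF cont[unfolded isCont_def] a] by (simp add: eventually_at_split)
    have e2: "eventually (\<lambda>x. 0 < x \<and> x < r) (at_left r)"
      using r by (auto simp: eventually_at_left[of 0] intro: exI[of _ 0])
    obtain x where x: "?h x < a" "0 < x" "x < r"
      using eventually_happens'[OF trivial_limit_at_left_real eventually_conj[OF e1 e2]] by blast
    have "(\<lambda>n. exp (- (V * x ^ CARD('d) * (q n * b n powr d))) + V * x ^ CARD('d) * (b n powr d * B.far n ((r - x) * b n)))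
        \<longlonglongrightarrow> ?h x + V * x ^ CARD('d) * 0"
      using x by (intro tendsto_intros qb far_0) auto
    then have "eventually (\<lambda>n. exp (- (V * x ^ CARD('d) * (q n * b n powr d)))
        + V * x ^ CARD('d) * (b n powr d * B.far n ((r - x) * b n)) < a) sequentially"
      using x by (intro order_tendstoD(2)) auto
    then show "eventually (\<lambda>n. P n < a) sequentially"
      using eventually_gt_at_top[of 0]
    proof eventually_elim
      case (elim n)
      have "r * b n - (r - x) * b n = x * b n" by (simp add: algebra_simps)
      then have "P n \<le> exp (- q n * (V * x ^ CARD('d) * b n powr d)) + V * x ^ CARD('d) * b n powr d * B.far n ((r - x) * b n)"
        using B.prob_vacant_upper[of n "(r - x) * b n" "r * b n"] elim x b_pos[of n] vol[of x n]
        by (simp add: P_def q_def)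
      then show ?case using elim(1) by (simp add: mult_ac)
    qed
  next
    fix a assume a: "a < ?h r"
    have e1: "eventually (\<lambda>x. a < ?h x) (at_right r)"
      using order_tendstoD(1)[OF cont[unfolded isCont_def] a] by (simp add: eventually_at_split)
    obtain x where x: "a < ?h x" "r < x"
      using eventually_happens'[OF trivial_limit_at_right_real eventually_conj[OF e1 eventually_at_right_less]] by blast
    \<comment> \<open>The error term carries the volume for radius \<open>r\<close>, not
      \<open>x\<close>, because the lower bound counts displaced lines by their end points in the
      ball to be vacant.\<close>
    have "(\<lambda>n. exp (- (V * x ^ CARD('d) * (q n * b n powr d))) - V * r ^ CARD('d) * (b n powr d * B.far n ((x - r) * b n)))
        \<longlonglongrightarrow> ?h x - V * r ^ CARD('d) * 0"
      using x by (intro tendsto_intros qb far_0) auto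
    then have "eventually (\<lambda>n. a < exp (- (V * x ^ CARD('d) * (q n * b n powr d)))
        - V * r ^ CARD('d) * (b n powr d * B.far n ((x - r) * b n))) sequentially"
      using x by (intro order_tendstoD(1)) auto
    then show "eventually (\<lambda>n. a < P n) sequentially"
      using eventually_gt_at_top[of 0]
    proof eventually_elim
      case (elim n)
      have "r * b n + (x - r) * b n = x * b n" by (simp add: algebra_simps)
      then have "P n \<ge> exp (- q n * (V * x ^ CARD('d) * b n powr d)) - V * r ^ CARD('d) * b n powr d * B.far n ((x - r) * b n)"
        using B.prob_vacant_lower[of n "(x - r) * b n" "r * b n"] elim x r b_pos[of n] vol[of x n] vol[of r n]
        by (simp add: P_def q_def)
      then show ?case using elim(1) by (simp add: mult_ac)
    qed
  qed
  moreover have "?h r = exp (- ball_volume CARD('d) r * (1 / \<beta>) powr (1 / \<beta>))"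
    by (simp add: V_def unit_ball_vol_def ball_volume_def C_def d_def)
  \<comment> \<open>At \<open>n = 0\<close> the scale \<open>b n\<close> is 0, so the reformulation
    by vacant balls is made for positive \<open>n\<close> only.\<close>
  moreover have "eventually (\<lambda>n. P n = measure M {\<omega> \<in> space M.
      brw_radius xi Y Xd n \<omega> / ereal ((real n * L (brw_survival M xi n)) powr (1 / (\<beta> * real CARD('d)))) \<ge> ereal r}) sequentially"
    using eventually_gt_at_top[of 0] by eventually_elim (use P_eq in \<open>simp add: b_def q_def d_def\<close>)
  ultimately show ?thesis by (simp add: tendsto_cong)
qed

end
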